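(* Let $p\ge 2$ and $k\ge 2$ be integers and let $G$ be a $(p,k)$-mixed mountain graph. Then the chromatic quasisymmetric function $X_G(x;q)$ is symmetric.
   Context: A $k$-mountain is a complete graph on $k$ vertices; a bottomless $(k+1)$-mountain is a complete graph on $k+1$ vertices with one edge removed. A $(p,k)$-mixed mountain graph is obtained by stringing together, from left to right, $p$ mountains, each being either a $k$-mountain or a bottomless $(k+1)$-mountain (any sequence is allowed), with consecutive mountains sharing a single vertex, where the shared vertices of a bottomless mountain are endpoints of its missing edge, and then joining the leftmost and rightmost vertices by one extra edge (the bottom edge); vertices are labeled $1,\ldots,n$ from left to right. Explicitly: choose types $t_1,\ldots,t_p\in\{\text{clique},\text{bottomless}\}$ and set $\ell_0=1$, $\ell_i=\ell_{i-1}+k-1$ if $t_i$ is clique, $\ell_i=\ell_{i-1}+k$ if $t_i$ is bottomless, and $n=\ell_p$. The vertex set is $[n]=\{1,\ldots,n\}$ and the edges are all $\{u,v\}$ with $\ell_{i-1}\le u<v\le \ell_i$ for some $i$, except the pairs $\{\ell_{i-1},\ell_i\}$ with $t_i$ bottomless, together with the bottom edge $\{1,n\}$. For a graph $G$ on $[n]$, a proper coloring is a map $\kappa:[n]\to\{1,2,3,\ldots\}$ taking distinct values on adjacent vertices, $\mathrm{asc}(\kappa)$ is the number of edges $\{u,v\}$ with $u<v$ and $\kappa(u)<\kappa(v)$, and $X_G(x;q)=\sum_\kappa q^{\mathrm{asc}(\kappa)}x_{\kappa(1)}\cdots x_{\kappa(n)}$ over all proper colorings. It is symmetric if it is invariant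 under all permutations of the variables $x_1,x_2,\ldots$. *)

theory Defs
  imports
    "HOL-Library.Multiset"
    "HOL-Library.FuncSet"
    "HOL-Computational_Algebra.Polynomial"
    "HOL-Combinatorics.Permutations"
begin

text \<open>
  A graph on the vertex set \<open>{1..n}\<close> is given by \<open>n\<close> and its set of edges, each edge being a
  two-element set of vertices.

  A formal power series in \<open>x\<^sub>1, x\<^sub>2, \<dots>\<close> is the function sending each monomial to its coefficient;
  the monomial \<open>x\<^bsub>i\<^sub>1\<^esub> \<cdots> x\<^bsub>i\<^sub>r\<^esub>\<close> is the multiset \<open>{#i\<^sub>1, \<dots>, i\<^sub>r#}\<close>.  There is no variable \<open>x\<^sub>0\<close>:
  the series of interest vanish on multisets containing \<open>0\<close>.
\<close>

type_synonym 'a power_series = "nat multiset \<Rightarrow> 'a"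

definition proper_colorings :: "nat \<Rightarrow> nat set set \<Rightarrow> (nat \<Rightarrow> nat) set" where
  "proper_colorings n E =
     {\<kappa> \<in> {1..n} \<rightarrow>\<^sub>E {1..}. \<forall>u v. {u, v} \<in> E \<longrightarrow> \<kappa> u \<noteq> \<kappa> v}"

definition asc :: "nat set set \<Rightarrow> (nat \<Rightarrow> nat) \<Rightarrow> nat" where
  "asc E \<kappa> = card {e \<in> E. \<exists>u v. e = {u, v} \<and> u < v \<and> \<kappa> u < \<kappa> v}"

text \<open>
  The coefficients are polynomials in \<open>q\<close>.  Only finitely many colorings contribute to a given
  monomial, see \<open>finite_colorings_of_monomial\<close> below.
\<close>

definition chromatic_quasisymmetric :: "nat \<Rightarrow> nat set set \<Rightarrow> int poly power_series" where
  "chromatic_quasisymmetric n E = (\<lambda>M.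
     \<Sum>\<kappa> | \<kappa> \<in> proper_colorings n E \<and> image_mset \<kappa> (mset_set {1..n}) = M. monom 1 (asc E \<kappa>))"

lemma finite_colorings_of_monomial:
  "finite {\<kappa>. \<kappa> \<in> proper_colorings n E \<and> image_mset \<kappa> (mset_set {1..n}) = M}"
proof (rule finite_subset)
  show "{\<kappa>. \<kappa> \<in> proper_colorings n E \<and> image_mset \<kappa> (mset_set {1..n}) = M}
          \<subseteq> {1..n} \<rightarrow>\<^sub>E set_mset M"
    by (auto simp: proper_colorings_def PiE_iff extensional_def)
  show "finite ({1..n} \<rightarrow>\<^sub>E set_mset M)"
    by (intro finite_PiE) auto
qed

text \<open>The substitution of \<open>x\<^bsub>\<sigma> i\<^esub>\<close> for every \<open>x\<^sub>i\<close>, for a permutation \<open>\<sigma>\<close>.\<close>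

definition permute_variables :: "(nat \<Rightarrow> nat) \<Rightarrow> 'a power_series \<Rightarrow> 'a power_series" where
  "permute_variables \<sigma> F = (\<lambda>M. F (image_mset (inv \<sigma>) M))"

definition symmetric_series :: "'a power_series \<Rightarrow> bool" where
  "symmetric_series F \<longleftrightarrow> (\<forall>\<sigma>. \<sigma> permutes {1..} \<longrightarrow> permute_variables \<sigma> F = F)"

datatype mountain_type = Clique | Bottomless

text \<open>
  For mountain types \<open>t 1, \<dots>, t p\<close>, the \<open>i\<close>-th mountain spans the vertices from
  \<open>mountain_end k t (i - 1)\<close> to \<open>mountain_end k t i\<close>.  The values of \<open>t\<close> outside \<open>{1..p}\<close> are
  irrelevant.
\<close>

primrec mountain_end :: "nat \<Rightarrow> (nat \<Rightarrow> mountain_type) \<Rightarrow> nat \<Rightarrow> nat" where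
  "mountain_end k t 0 = 1"
| "mountain_end k t (Suc i) =
     mountain_end k t i + (case t (Suc i) of Clique \<Rightarrow> k - 1 | Bottomless \<Rightarrow> k)"

definition mixed_mountain_edges :: "nat \<Rightarrow> nat \<Rightarrow> (nat \<Rightarrow> mountain_type) \<Rightarrow> nat set set" where
  "mixed_mountain_edges p k t =
     ({{u, v} | u v. u < v \<and> (\<exists>i\<in>{1..p}. mountain_end k t (i - 1) \<le> u \<and> v \<le> mountain_end k t i)}
       - {{mountain_end k t (i - 1), mountain_end k t i} | i. i \<in> {1..p} \<and> t i = Bottomless})
     \<union> {{1, mountain_end k t p}}"

definition mixed_mountain_graph :: "nat \<Rightarrow> nat \<Rightarrow> nat \<Rightarrow> nat set set \<Rightarrow> bool" where
  "mixed_mountain_graph p k n E \<longleftrightarrow>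
     (\<exists>t. n = mountain_end k t p \<and> E = mixed_mountain_edges p k t)"

end

theory Submission
  imports Defs "HOL-Library.Poly_Mapping" "HOL-Library.Multiset_Order"
begin

text \<open>
  The symmetric group is generated by adjacent transpositions, so it suffices to exchange the
  variables of two adjacent colors \<open>a < b\<close>, and only finitely many colors matter for a given
  coefficient.  Let \<open>K c d\<close> be the weight \<open>q\<close>, \<open>0\<close> or \<open>1\<close> of an edge whose left end has color \<open>c\<close>
  and whose right end has color \<open>d\<close>.

  A mountain is glued to the rest of its string only at its two end vertices, so it acts as a matrix
  indexed by colors: the entry at \<open>(c, d)\<close> sums the weights of its colorings with end colors \<open>c\<close> and
  \<open>d\<close>, leaving out the variable of the left end.  If \<open>U\<close> is the product of the matrices of all
  mountains, then the chromatic quasisymmetric function, in finitely many variables, is the sum of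
  \<open>K c d * x c * U c d\<close>, where the factor \<open>K c d\<close> comes from the bottom edge.  Apart from
  a \<open>q\<close>-factorial, the variable of the right end and possibly a factor \<open>K c d\<close>, the entries of a
  mountain matrix are elementary symmetric polynomials in variables scaled by powers of \<open>q\<close> or by
  zero.

  Write \<open>U'\<close> for \<open>U\<close> after the exchange of \<open>x a\<close> and \<open>x b\<close>.  Two facts about \<open>U\<close> are needed.

  First, there is an explicit matrix \<open>\<Gamma>\<close>, scalar away from the colors \<open>a\<close> and \<open>b\<close>, with
  \<open>\<Gamma> U = U' \<Gamma>\<close> (\<open>intertwined_string\<close>).  This is the local symmetry that also makes the string without
  its bottom edge symmetric, written so that it passes to products.  It determines \<open>U'\<close>, but it does
  not imply that closing the string with the bottom edge is symmetric: a two-colored path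
  through the bottom edge is not monotone, and flipping its colors can change the number of ascents.

  Second, the missing relation between the four entries of \<open>U\<close> at \<open>a\<close> and \<open>b\<close> comes from
  commutation.  There is a matrix \<open>L\<close>, depending only on \<open>k\<close> and the variables, such that the clique matrix \<open>C\<close> and the
  bottomless matrix \<open>B\<close> satisfy \<open>C L = L C = B\<close> (\<open>clique_link\<close>, \<open>link_clique\<close>).  Hence \<open>L\<close> commutes
  with both kinds of mountains and with \<open>U\<close>.  Since \<open>L\<close>, apart from the variables, does not
  distinguish \<open>a\<close> from \<open>b\<close> as partners of any other color, comparing rows and columns \<open>a\<close> and \<open>b\<close> in \<open>U L = L U\<close> leaves a linear relation
  among the entries of \<open>U\<close> at \<open>a\<close> and \<open>b\<close> (\<open>commutes_with_link\<close>).  Together with the first fact it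
  gives \<open>x b * U' a b = x a * U a b\<close> and \<open>x a * U' b a = x b * U b a\<close>, and then the whole sum is
  unchanged (\<open>closing_edge_swap\<close>).
\<close>

section \<open>Edge weights and \<open>q\<close>-numbers\<close>

definition edge_weight :: "'r::comm_ring_1 \<Rightarrow> 'c::linorder \<Rightarrow> 'c \<Rightarrow> 'r" where
  "edge_weight q c d = (if c < d then q else if c = d then 0 else 1)"

definition qnum :: "'r::comm_ring_1 \<Rightarrow> nat \<Rightarrow> 'r" where
  "qnum q m = (\<Sum>i<m. q ^ i)"

definition qfact :: "'r::comm_ring_1 \<Rightarrow> nat \<Rightarrow> 'r" where
  "qfact q m = (\<Prod>i<m. qnum q (Suc i))"

definition elementary :: "'c set \<Rightarrow> ('c \<Rightarrow> 'r::comm_ring_1) \<Rightarrow> nat \<Rightarrow> 'r" where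
  "elementary A g m = (\<Sum>S | S \<subseteq> A \<and> card S = m. \<Prod>s\<in>S. g s)"

lemma qnum_Suc: "qnum q (Suc m) = qnum q m + q ^ m"
  by (simp add: qnum_def)

lemma qnum_add: "qnum q (m + n) = qnum q m + q ^ m * qnum q n"
  by (induction n) (simp_all add: qnum_def algebra_simps power_add)

lemma qnum_geometric: "(1 - q) * qnum q m = 1 - q ^ m"
proof (induction m)
  case (Suc m)
  then show ?case
    unfolding qnum_Suc distrib_left by (simp add: algebra_simps)
qed (simp add: qnum_def)

lemma qfact_Suc: "qfact q (Suc m) = qnum q (Suc m) * qfact q m"
  by (simp add: qfact_def mult.commute)

lemma edge_weight_self [simp]: "edge_weight q c c = 0"
  by (simp add: edge_weight_def)

text \<open>The exponents are the ranks \<open>0, \<dots>, card R - 1\<close> of the elements of \<open>R\<close>.\<close>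

lemma sum_power_rank:
  fixes R :: "'c::linorder set"
  assumes "finite R"
  shows "(\<Sum>s\<in>R. q ^ card {u\<in>R. u < s}) = qnum q (card R)"
  using assms
proof (induction R rule: finite_linorder_max_induct)
  case empty
  then show ?case by (simp add: qnum_def)
next
  case (insert b R)
  have "{u \<in> insert b R. u < b} = R"
    using insert.hyps by auto
  moreover have "{u \<in> insert b R. u < s} = {u\<in>R. u < s}" if "s \<in> R" for s
    using insert.hyps that by auto
  moreover have "b \<notin> R"
    using insert.hyps by auto
  ultimately show ?case
    using insert by (simp add: qnum_Suc add.commute)
qed

lemma prod_edge_weight_to:
  assumes "finite R" "s \<notin> R"
  shows "(\<Prod>u\<in>R. edge_weight q u s) = q ^ card {u\<in>R. u < s}"
proof -
  have "(\<Prod>u\<in>R. edge_weight q u s) = (\<Prod>u\<in>R. if u < s then q else 1)"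
    using assms by (intro prod.cong) (auto simp: edge_weight_def)
  also have "\<dots> = q ^ card {u\<in>R. u < s}"
    using assms by (simp add: prod.If_cases Int_def)
  finally show ?thesis .
qed

lemma sum_prod_edge_weight:
  assumes "finite R"
  shows "(\<Sum>s\<in>R. \<Prod>u\<in>R - {s}. edge_weight q u s) = qnum q (card R)"
proof -
  have "(\<Prod>u\<in>R - {s}. edge_weight q u s) = q ^ card {u\<in>R. u < s}" if "s \<in> R" for s
  proof -
    have "{u\<in>R - {s}. u < s} = {u\<in>R. u < s}" by auto
    then show ?thesis
      using assms prod_edge_weight_to[of "R - {s}" s q] by simp
  qed
  then show ?thesis
    using sum_power_rank[OF assms, of q] by simp
qed

text \<open>
  The value on the diagonal is forced by the next lemma: it makes the sum vanish when \<open>d \<in> R\<close>, as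
  the right-hand side does.  With \<open>k = m + 2\<close>, these are, up to a variable for each column, the
  entries of the matrix that turns a \<open>k\<close>-mountain into a bottomless \<open>(k+1)\<close>-mountain.
\<close>

definition link :: "'r::comm_ring_1 \<Rightarrow> nat \<Rightarrow> 'c::linorder \<Rightarrow> 'c \<Rightarrow> 'r" where
  "link q m c d = (if c < d then q ^ Suc m else if c = d then - q * qnum q m else 1)"

text \<open>
  The products on the left are \<open>q\<close> to the rank of \<open>s\<close> in \<open>R\<close>.  Let \<open>l\<close> elements of \<open>R\<close> lie
  below \<open>d\<close>.  If \<open>d \<notin> R\<close>, these contribute the exponents \<open>m + 1, \<dots>, m + l\<close> and the others the
  exponents \<open>l, \<dots>, m\<close>; together they form an interval of length \<open>m + 1\<close> starting at \<open>l\<close>.  If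
  \<open>d \<in> R\<close>, the exponent \<open>l\<close> drops out, and the remaining interval is cancelled by the
  diagonal term.
\<close>

lemma sum_link_to:
  fixes R :: "'c::linorder set"
  assumes R: "finite R" "card R = Suc m"
  shows "(\<Sum>s\<in>R. (\<Prod>u\<in>R - {s}. edge_weight q u s) * link q m s d)
           = qnum q (Suc m) * (\<Prod>u\<in>R. edge_weight q u d)"
proof -
  define L H where "L = {u\<in>R. u < d}" and "H = {u\<in>R. d < u}"
  let ?r = "\<lambda>s. q ^ card {u\<in>R. u < s}"
  have fin: "finite L" "finite H" using R by (auto simp: L_def H_def)
  have rank: "(\<Prod>u\<in>R - {s}. edge_weight q u s) = ?r s" for s
  proof -
    have "{u\<in>R - {s}. u < s} = {u\<in>R. u < s}" by auto
    then show ?thesis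
      using R prod_edge_weight_to[of "R - {s}" s q] by simp
  qed
  have "{u\<in>R. u < s} = {u\<in>L. u < s}" if "s \<in> L" for s
    using that by (auto simp: L_def)
  then have sumL: "(\<Sum>s\<in>L. ?r s) = qnum q (card L)"
    using sum_power_rank[OF fin(1), of q] by simp
  have RH: "card {u\<in>R. u < s} = card (R - H) + card {u\<in>H. u < s}" if "s \<in> H" for s
  proof -
    have "{u\<in>R. u < s} = (R - H) \<union> {u\<in>H. u < s}"
      using that by (auto simp: H_def)
    then show ?thesis
      using R fin by (simp add: card_Un_disjoint disjoint_iff)
  qed
  then have sumH: "(\<Sum>s\<in>H. ?r s) = q ^ card (R - H) * qnum q (card H)"
    using sum_power_rank[OF fin(2), of q] by (simp add: power_add sum_distrib_left [symmetric])
  show ?thesis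
  proof (cases "d \<in> R")
    case False
    then have U: "R = L \<union> H" "L \<inter> H = {}" by (auto simp: L_def H_def not_less_iff_gr_or_eq)
    then have c: "Suc m = card L + card H" "R - H = L"
      using R fin by (auto simp: card_Un_disjoint)
    have "(\<Sum>s\<in>R. ?r s * link q m s d)
        = (\<Sum>s\<in>L. ?r s * q ^ Suc m) + (\<Sum>s\<in>H. ?r s)"
    proof -
      have "(\<Sum>s\<in>R. ?r s * link q m s d)
          = (\<Sum>s\<in>L. ?r s * link q m s d) + (\<Sum>s\<in>H. ?r s * link q m s d)"
        using fin U by (metis (lifting) sum.union_disjoint)
      also have "\<dots> = (\<Sum>s\<in>L. ?r s * q ^ Suc m) + (\<Sum>s\<in>H. ?r s)"
        by (intro arg_cong2[where f="(+)"] sum.cong) (auto simp: L_def H_def link_def)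
      finally show ?thesis .
    qed
    also have "\<dots> = q ^ Suc m * qnum q (card L) + q ^ card L * qnum q (card H)"
    proof -
      have "(\<Sum>s\<in>L. ?r s * q ^ Suc m) = qnum q (card L) * q ^ Suc m"
        by (simp only: sum_distrib_right [symmetric] sumL)
      then show ?thesis
        by (simp only: sumH c(2) mult.commute)
    qed
    also have "\<dots> = q ^ card L * qnum q (card H + card L)"
      unfolding c(1) qnum_add by (simp add: algebra_simps power_add)
    finally show ?thesis
      using R False c prod_edge_weight_to[of R d q]
      by (simp add: rank L_def[symmetric] mult.commute add.commute)
  next
    case True
    then have U: "R = insert d (L \<union> H)" "L \<inter> H = {}" "d \<notin> L" "d \<notin> H" by (auto simp: L_def H_def not_less_iff_gr_or_eq)
    then have c: "m = card L + card H" "R - H = insert d L"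
      using R fin by (auto simp: card_Un_disjoint)
    have "(\<Sum>s\<in>R. ?r s * link q m s d)
        = q ^ card L * (- q * qnum q m) + ((\<Sum>s\<in>L. ?r s * q ^ Suc m) + (\<Sum>s\<in>H. ?r s))"
    proof -
      have "(\<Sum>s\<in>R. ?r s * link q m s d) = ?r d * link q m d d + (\<Sum>s\<in>L \<union> H. ?r s * link q m s d)"
      proof -
        have "R - {d} = L \<union> H" using U by auto
        then show ?thesis using sum.remove[OF R(1) True] by simp
      qed
      also have "(\<Sum>s\<in>L \<union> H. ?r s * link q m s d)
          = (\<Sum>s\<in>L. ?r s * link q m s d) + (\<Sum>s\<in>H. ?r s * link q m s d)"
        using fin U(2) by (simp add: sum.union_disjoint)
      also have "\<dots> = (\<Sum>s\<in>L. ?r s * q ^ Suc m) + (\<Sum>s\<in>H. ?r s)"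
        by (intro arg_cong2[where f="(+)"] sum.cong) (auto simp: L_def H_def link_def)
      finally show ?thesis by (simp add: L_def link_def)
    qed
    also have "\<dots> = q ^ Suc m * qnum q (card L) + q ^ Suc (card L) * qnum q (card H)
                     - q ^ Suc (card L) * qnum q (card H + card L)"
    proof -
      have "(\<Sum>s\<in>L. ?r s * q ^ Suc m) = qnum q (card L) * q ^ Suc m"
        by (simp only: sum_distrib_right [symmetric] sumL)
      moreover have "(\<Sum>s\<in>H. ?r s) = q ^ Suc (card L) * qnum q (card H)"
        using sumH c(2) fin U(3) by simp
      ultimately show ?thesis
        by (simp add: c(1) algebra_simps)
    qed
    also have "\<dots> = 0"
      unfolding c(1) qnum_add by (simp add: algebra_simps power_add)
    finally have "(\<Sum>s\<in>R. ?r s * link q m s d) = 0" .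
    moreover have "(\<Prod>u\<in>R. edge_weight q u d) = 0"
      using True R by (intro prod_zero bexI[of _ d]) auto
    ultimately show ?thesis
      by (simp add: rank)
  qed
qed

text \<open>The mirror image of the previous lemma, by the order-reversing map \<open>c \<mapsto> - c\<close> on colors.\<close>

lemma sum_link_from:
  fixes R :: "nat set"
  assumes R: "finite R" "card R = Suc m"
  shows "(\<Sum>s\<in>R. link q m c s * (\<Prod>u\<in>R - {s}. edge_weight q s u))
           = qnum q (Suc m) * (\<Prod>u\<in>R. edge_weight q c u)"
proof -
  define f where "f = (\<lambda>u::nat. - int u)"
  have inj: "inj_on f S" for S by (simp add: inj_on_def f_def)
  have K: "edge_weight q (f u) (f s) = edge_weight q s u" for u s
    by (auto simp: edge_weight_def f_def)
  have J: "link q m (f u) (f s) = link q m s u" for u s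
    by (auto simp: link_def f_def)
  have img: "f ` R - {f s} = f ` (R - {s})" if "s \<in> R" for s
    using inj by (auto simp: inj_on_def)
  have "(\<Sum>s\<in>R. link q m c s * (\<Prod>u\<in>R - {s}. edge_weight q s u))
      = (\<Sum>s\<in>f ` R. (\<Prod>u\<in>f ` R - {s}. edge_weight q u s) * link q m s (f c))"
    by (simp add: sum.reindex[OF inj] prod.reindex[OF inj] img K J mult.commute)
  also have "\<dots> = qnum q (Suc m) * (\<Prod>u\<in>f ` R. edge_weight q u (f c))"
    using R by (intro sum_link_to) (simp_all add: card_image[OF inj])
  finally show ?thesis
    by (simp add: prod.reindex[OF inj] K)
qed

text \<open>
  The reindexing behind all uses of the sums over \<open>s \<in> R\<close>: a vertex of color \<open>s\<close> joined completely to a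
  clique colored by the set \<open>S\<close> forms a larger clique colored by \<open>insert s S\<close>.
\<close>

lemma sum_over_subset_with_element:
  assumes "finite A" and "\<And>s S. S \<subseteq> A \<Longrightarrow> s \<in> S \<Longrightarrow> f s S = (0::'r::comm_ring_1)"
  shows "(\<Sum>s\<in>A. \<Sum>S | S \<subseteq> A \<and> card S = m. f s S)
           = (\<Sum>R | R \<subseteq> A \<and> card R = Suc m. \<Sum>s\<in>R. f s (R - {s}))"
proof -
  have fin: "finite {S. S \<subseteq> A \<and> card S = m}" for m
    using assms(1) by simp
  have finR: "finite R" if "R \<subseteq> A" for R
    using that assms(1) finite_subset by blast
  have "(\<Sum>s\<in>A. \<Sum>S | S \<subseteq> A \<and> card S = m. f s S)
      = (\<Sum>(s, S)\<in>A \<times> {S. S \<subseteq> A \<and> card S = m}. f s S)"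
    by (simp add: sum.cartesian_product)
  also have "\<dots> = (\<Sum>(s, S)\<in>{(s, S). s \<in> A - S \<and> S \<subseteq> A \<and> card S = m}. f s S)"
    using assms fin by (intro sum.mono_neutral_right) auto
  also have "\<dots> = (\<Sum>(R, s)\<in>(SIGMA R:{R. R \<subseteq> A \<and> card R = Suc m}. R). f s (R - {s}))"
    by (intro sum.reindex_bij_witness[where i="\<lambda>(R, s). (s, R - {s})" and j="\<lambda>(s, S). (insert s S, s)"])
      (auto dest: finR simp: card_Diff_singleton)
  also have "\<dots> = (\<Sum>R | R \<subseteq> A \<and> card R = Suc m. \<Sum>s\<in>R. f s (R - {s}))"
    using assms(1) fin finR by (subst sum.Sigma) auto
  finally show ?thesis .
qed

lemma elementary_insert:
  assumes "finite A" "a \<notin> A"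
  shows "elementary (insert a A) g m
           = elementary A g m + g a * (if m = 0 then 0 else elementary A g (m - 1))"
proof (cases m)
  case 0
  have "{S. S \<subseteq> B \<and> card S = 0} = {{}}" if "finite B" for B :: "'a set"
    using that by (auto simp: card_eq_0_iff dest: finite_subset)
  then show ?thesis using assms 0 by (simp add: elementary_def)
next
  case (Suc m')
  have split: "{S. S \<subseteq> insert a A \<and> card S = m}
      = {S. S \<subseteq> A \<and> card S = m} \<union> insert a ` {S. S \<subseteq> A \<and> card S = m'}"
    (is "?X = ?Y \<union> _ ` ?Z")
  proof (intro equalityI subsetI)
    fix S assume S: "S \<in> ?X"
    show "S \<in> ?Y \<union> insert a ` ?Z"
    proof (cases "a \<in> S")
      case True
      then have "S = insert a (S - {a})" "S - {a} \<in> ?Z"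
        using S Suc by (auto simp: card_Diff_singleton)
      then show ?thesis by blast
    qed (use S in auto)
  next
    fix S assume "S \<in> ?Y \<union> insert a ` ?Z"
    then show "S \<in> ?X"
    proof
      assume "S \<in> insert a ` ?Z"
      then obtain T where "S = insert a T" "T \<subseteq> A" "card T = m'" by auto
      moreover have "finite T" "a \<notin> T" using \<open>T \<subseteq> A\<close> assms finite_subset by auto
      ultimately show ?thesis using Suc by auto
    qed auto
  qed
  have inj: "inj_on (insert a) ?Z"
    using assms by (intro inj_onI) (metis (no_types, lifting) insert_ident mem_Collect_eq subsetD)
  have "elementary (insert a A) g m
      = (\<Sum>S\<in>?Y. \<Prod>s\<in>S. g s) + (\<Sum>S\<in>insert a ` ?Z. \<Prod>s\<in>S. g s)"
    unfolding elementary_def split using assms by (intro sum.union_disjoint) auto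
  also have "(\<Sum>S\<in>insert a ` ?Z. \<Prod>s\<in>S. g s) = (\<Sum>S\<in>?Z. g a * (\<Prod>s\<in>S. g s))"
    unfolding sum.reindex[OF inj] o_def
  proof (intro sum.cong refl)
    fix S assume "S \<in> ?Z"
    then have "finite S" "a \<notin> S" using assms finite_subset by auto
    then show "(\<Prod>s\<in>insert a S. g s) = g a * (\<Prod>s\<in>S. g s)" by simp
  qed
  finally show ?thesis
    using Suc by (simp add: elementary_def sum_distrib_left)
qed

lemma elementary_cong:
  assumes "\<And>s. s \<in> A \<Longrightarrow> g s = h s"
  shows "elementary A g m = elementary A h m"
  unfolding elementary_def using assms by (intro sum.cong prod.cong) auto


section \<open>Mountain matrices and the link matrix\<close>

text \<open>
  The colors in use form a finite set \<open>A\<close> that varies, hence matrix products are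
  taken over an explicit index set.
\<close>

definition mmult :: "'c set \<Rightarrow> ('c \<Rightarrow> 'c \<Rightarrow> 'r::comm_ring_1) \<Rightarrow> ('c \<Rightarrow> 'c \<Rightarrow> 'r) \<Rightarrow> 'c \<Rightarrow> 'c \<Rightarrow> 'r" where
  "mmult A U V c d = (\<Sum>e\<in>A. U c e * V e d)"

lemma mmult_assoc: "mmult A (mmult A U V) W = mmult A U (mmult A V W)"
proof (intro ext)
  fix c d
  have "(\<Sum>e\<in>A. \<Sum>f\<in>A. U c f * V f e * W e d) = (\<Sum>f\<in>A. \<Sum>e\<in>A. U c f * V f e * W e d)"
    by (rule sum.swap)
  then show "mmult A (mmult A U V) W c d = mmult A U (mmult A V W) c d"
    by (simp add: mmult_def sum_distrib_left sum_distrib_right mult.assoc)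
qed

lemma mmult_cong:
  assumes "\<And>e. e \<in> A \<Longrightarrow> U c e = U' c e" "\<And>e. e \<in> A \<Longrightarrow> V e d = V' e d"
  shows "mmult A U V c d = mmult A U' V' c d"
  using assms by (simp add: mmult_def)

text \<open>
  In the three matrices below, \<open>m = k - 2\<close>, which is the number of interior vertices of a
  \<open>k\<close>-mountain; a bottomless mountain has one more.  The variable \<open>x d\<close> of the right end is included
  and that of the left end is not, so that the matrix product counts every shared vertex once.
\<close>

definition clique_matrix ::
  "'r::comm_ring_1 \<Rightarrow> 'c::linorder set \<Rightarrow> ('c \<Rightarrow> 'r) \<Rightarrow> nat \<Rightarrow> 'c \<Rightarrow> 'c \<Rightarrow> 'r" where
  "clique_matrix q A x m c d = edge_weight q c d * qfact q m
     * elementary A (\<lambda>s. edge_weight q c s * edge_weight q s d * x s) m * x d"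

definition bottomless_matrix ::
  "'r::comm_ring_1 \<Rightarrow> 'c::linorder set \<Rightarrow> ('c \<Rightarrow> 'r) \<Rightarrow> nat \<Rightarrow> 'c \<Rightarrow> 'c \<Rightarrow> 'r" where
  "bottomless_matrix q A x m c d = qfact q (Suc m)
     * elementary A (\<lambda>s. edge_weight q c s * edge_weight q s d * x s) (Suc m) * x d"

definition link_matrix ::
  "'r::comm_ring_1 \<Rightarrow> ('c::linorder \<Rightarrow> 'r) \<Rightarrow> nat \<Rightarrow> 'c \<Rightarrow> 'c \<Rightarrow> 'r" where
  "link_matrix q x m c d = link q m c d * x d"

text \<open>
  Expanding the elementary polynomial, a term chooses the colors \<open>S\<close> of the interior and the color
  \<open>s\<close> of the right end of a clique.  For a fixed set \<open>R = insert s S\<close>, the sum over \<open>s\<close> is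
  evaluated by \<open>sum_link_to\<close>.
\<close>

lemma clique_link:
  fixes A :: "'c::linorder set"
  assumes "finite A"
  shows "mmult A (clique_matrix q A x m) (link_matrix q x m) = bottomless_matrix q A x m"
proof (intro ext)
  fix c d
  define f where "f s S = edge_weight q c s * qfact q m * (\<Prod>u\<in>S. edge_weight q c u * edge_weight q u s * x u)
                        * x s * (link q m s d * x d)" for s S
  have finR: "finite R" if "R \<subseteq> A" for R
    using that assms finite_subset by blast
  have inner: "(\<Sum>s\<in>R. f s (R - {s}))
      = qfact q (Suc m) * (\<Prod>u\<in>R. edge_weight q c u * edge_weight q u d * x u) * x d"
    if R: "R \<subseteq> A" "card R = Suc m" for R
  proof -
    have "f s (R - {s}) = qfact q m * x d * (\<Prod>u\<in>R. edge_weight q c u * x u)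
            * ((\<Prod>u\<in>R - {s}. edge_weight q u s) * link q m s d)" if "s \<in> R" for s
      using that finR[OF R(1)]
      by (simp add: f_def prod.distrib prod.remove[of R s] mult_ac)
    then have "(\<Sum>s\<in>R. f s (R - {s})) = qfact q m * x d * (\<Prod>u\<in>R. edge_weight q c u * x u)
         * (\<Sum>s\<in>R. (\<Prod>u\<in>R - {s}. edge_weight q u s) * link q m s d)"
      by (simp add: sum_distrib_left)
    also have "\<dots> = qfact q m * x d * (\<Prod>u\<in>R. edge_weight q c u * x u)
         * (qnum q (Suc m) * (\<Prod>u\<in>R. edge_weight q u d))"
      by (simp only: sum_link_to[OF finR[OF R(1)] R(2)])
    finally show ?thesis
      by (simp add: qfact_Suc prod.distrib mult_ac)
  qed
  have "mmult A (clique_matrix q A x m) (link_matrix q x m) c d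
      = (\<Sum>s\<in>A. \<Sum>S | S \<subseteq> A \<and> card S = m. f s S)"
    by (simp add: mmult_def clique_matrix_def link_matrix_def elementary_def f_def
        sum_distrib_left sum_distrib_right)
  also have "\<dots> = (\<Sum>R | R \<subseteq> A \<and> card R = Suc m. \<Sum>s\<in>R. f s (R - {s}))"
  proof (intro sum_over_subset_with_element assms)
    fix s S assume "S \<subseteq> A" "s \<in> S"
    then have "(\<Prod>u\<in>S. edge_weight q c u * edge_weight q u s * x u) = 0"
      by (intro prod_zero finR bexI[of _ s]) auto
    then show "f s S = 0" by (simp add: f_def)
  qed
  also have "\<dots> = bottomless_matrix q A x m c d"
    by (simp add: inner bottomless_matrix_def elementary_def sum_distrib_left sum_distrib_right)
  finally show "mmult A (clique_matrix q A x m) (link_matrix q x m) c d = bottomless_matrix q A x m c d" .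
qed

lemma link_clique:
  fixes A :: "nat set"
  assumes "finite A"
  shows "mmult A (link_matrix q x m) (clique_matrix q A x m) = bottomless_matrix q A x m"
proof (intro ext)
  fix c d
  define f where "f s S = link q m c s * x s * (edge_weight q s d * qfact q m
                        * (\<Prod>u\<in>S. edge_weight q s u * edge_weight q u d * x u) * x d)" for s S
  have finR: "finite R" if "R \<subseteq> A" for R
    using that assms finite_subset by blast
  have inner: "(\<Sum>s\<in>R. f s (R - {s}))
      = qfact q (Suc m) * (\<Prod>u\<in>R. edge_weight q c u * edge_weight q u d * x u) * x d"
    if R: "R \<subseteq> A" "card R = Suc m" for R
  proof -
    have "f s (R - {s}) = qfact q m * x d * (\<Prod>u\<in>R. edge_weight q u d * x u)
            * (link q m c s * (\<Prod>u\<in>R - {s}. edge_weight q s u))" if "s \<in> R" for s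
      using that finR[OF R(1)]
      by (simp add: f_def prod.distrib prod.remove[of R s] mult_ac)
    then have "(\<Sum>s\<in>R. f s (R - {s})) = qfact q m * x d * (\<Prod>u\<in>R. edge_weight q u d * x u)
         * (\<Sum>s\<in>R. link q m c s * (\<Prod>u\<in>R - {s}. edge_weight q s u))"
      by (simp add: sum_distrib_left)
    also have "\<dots> = qfact q m * x d * (\<Prod>u\<in>R. edge_weight q u d * x u)
         * (qnum q (Suc m) * (\<Prod>u\<in>R. edge_weight q c u))"
      by (simp only: sum_link_from[OF finR[OF R(1)] R(2)])
    finally show ?thesis
      by (simp add: qfact_Suc prod.distrib mult_ac)
  qed
  have "mmult A (link_matrix q x m) (clique_matrix q A x m) c d
      = (\<Sum>s\<in>A. \<Sum>S | S \<subseteq> A \<and> card S = m. f s S)"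
    by (simp add: mmult_def clique_matrix_def link_matrix_def elementary_def f_def
        sum_distrib_left sum_distrib_right)
  also have "\<dots> = (\<Sum>R | R \<subseteq> A \<and> card R = Suc m. \<Sum>s\<in>R. f s (R - {s}))"
  proof (intro sum_over_subset_with_element assms)
    fix s S assume "S \<subseteq> A" "s \<in> S"
    then have "(\<Prod>u\<in>S. edge_weight q s u * edge_weight q u d * x u) = 0"
      by (intro prod_zero finR bexI[of _ s]) auto
    then show "f s S = 0" by (simp add: f_def)
  qed
  also have "\<dots> = bottomless_matrix q A x m c d"
    by (simp add: inner bottomless_matrix_def elementary_def sum_distrib_left sum_distrib_right)
  finally show "mmult A (link_matrix q x m) (clique_matrix q A x m) c d = bottomless_matrix q A x m c d" .
qed

section \<open>Exchanging two adjacent colors\<close>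

lemma link_Suc_sum: "1 + q * qnum q m = qnum q (Suc m)"
  using qnum_add[of q 1 m] by (simp add: qnum_def)

locale adjacent_colors =
  fixes A :: "nat set" and a b :: nat and q :: "'r::idom" and x :: "nat \<Rightarrow> 'r"
  assumes finite_colors: "finite A" and mem: "a \<in> A" "b \<in> A" and less: "a < b"
    and adjacent: "\<And>c. c \<in> A \<Longrightarrow> c \<noteq> a \<Longrightarrow> c \<noteq> b \<Longrightarrow> c < a \<or> b < c"
begin

definition x' :: "nat \<Rightarrow> 'r" where "x' = x \<circ> transpose a b"

lemma x'_simps [simp]: "x' a = x b" "x' b = x a" "c \<noteq> a \<Longrightarrow> c \<noteq> b \<Longrightarrow> x' c = x c"
  by (simp_all add: x'_def transpose_def)

lemma a_neq_b [simp]: "a \<noteq> b" "b \<noteq> a"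
  using less by auto

lemma edge_weight_adjacent:
  assumes "c \<in> A" "c \<noteq> a" "c \<noteq> b"
  shows "edge_weight q c b = edge_weight q c a" "edge_weight q b c = edge_weight q a c"
    "link q m c b = link q m c a" "link q m b c = link q m a c"
  using adjacent[OF assms] less assms(2,3) by (auto simp: edge_weight_def link_def)

lemma sum_split: "(\<Sum>e\<in>A. f e) = f a + f b + (\<Sum>e\<in>A - {a, b}. f e)" for f :: "nat \<Rightarrow> 'r"
proof -
  have "A = insert a (insert b (A - {a, b}))" using mem by auto
  then have "(\<Sum>e\<in>A. f e) = (\<Sum>e\<in>insert a (insert b (A - {a, b})). f e)" by simp
  also have "\<dots> = f a + f b + (\<Sum>e\<in>A - {a, b}. f e)"
    using finite_colors by (simp add: add.assoc)
  finally show ?thesis .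
qed

lemma link_adjacent:
  "link q m a a = - (q * qnum q m)" "link q m b b = - (q * qnum q m)"
  "link q m a b = q + (q - 1) * (q * qnum q m)" "link q m b a = 1"
proof -
  have "q * ((1 - q) * qnum q m) = q * (1 - q ^ m)"
    by (simp only: qnum_geometric)
  then have "q ^ Suc m = q + (q - 1) * (q * qnum q m)"
    by (simp add: algebra_simps)
  then show "link q m a b = q + (q - 1) * (q * qnum q m)"
    using less by (simp add: link_def)
qed (use less in \<open>auto simp: link_def\<close>)

text \<open>
  This is the matrix \<open>\<Gamma>\<close> of the introduction.  Its rows at \<open>a\<close> and \<open>b\<close> have the form of a
  Demazure--Lusztig operator, with the denominator \<open>z a - q * z b\<close> moved to the scalar part.  The
  reason for its entries is the shape of a clique matrix \<open>C\<close>: for \<open>c\<close> other than \<open>a\<close> and \<open>b\<close>, the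
  row vector \<open>(C c a, C c b)\<close> is a combination of \<open>(x a, x b)\<close> and \<open>x a * x b * (1, q)\<close> with
  coefficients symmetric in \<open>x a\<close> and \<open>x b\<close>.  The first of these vectors becomes \<open>(x b, x a)\<close> under
  the exchange of the variables and the second is unchanged; multiplication by \<open>\<Gamma>\<close> then takes both
  to \<open>x a - q * x b\<close> times the original vectors.
\<close>

definition exchange :: "(nat \<Rightarrow> 'r) \<Rightarrow> nat \<Rightarrow> nat \<Rightarrow> 'r" where
  "exchange z c d =
     (if c = a then (if d = a then z a * (1 - q) else if d = b then q * (z a - z b) else 0)
      else if c = b then (if d = a then z a - z b else if d = b then z b * (1 - q) else 0)
      else if d = c then z a - q * z b else 0)"

lemma exchange_left:
  assumes "c \<in> A"
  shows "mmult A (exchange z) V c d =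
     (if c = a then z a * (1 - q) * V a d + q * (z a - z b) * V b d
      else if c = b then (z a - z b) * V a d + z b * (1 - q) * V b d
      else (z a - q * z b) * V c d)"
proof (cases "c = a \<or> c = b")
  case True
  have "(\<Sum>e\<in>A - {a, b}. exchange z c e * V e d) = 0"
    using True by (intro sum.neutral) (auto simp: exchange_def)
  then show ?thesis
    using True unfolding mmult_def sum_split by (auto simp: exchange_def)
next
  case False
  then have "exchange z c e * V e d = (if e = c then (z a - q * z b) * V c d else 0)" for e
    by (auto simp: exchange_def)
  then show ?thesis
    using False assms finite_colors unfolding mmult_def by simp
qed

lemma exchange_right:
  assumes "d \<in> A"
  shows "mmult A V (exchange z) c d =
     (if d = a then V c a * (z a * (1 - q)) + V c b * (z a - z b)
      else if d = b then V c a * (q * (z a - z b)) + V c b * (z b * (1 - q))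
      else V c d * (z a - q * z b))"
proof (cases "d = a \<or> d = b")
  case True
  have "(\<Sum>e\<in>A - {a, b}. V c e * exchange z e d) = 0"
    using True by (intro sum.neutral) (auto simp: exchange_def)
  then show ?thesis
    using True unfolding mmult_def sum_split by (auto simp: exchange_def)
next
  case False
  then have "V c e * exchange z e d = (if e = d then V c d * (z a - q * z b) else 0)" for e
    by (auto simp: exchange_def)
  then show ?thesis
    using False assms finite_colors unfolding mmult_def by simp
qed

definition intertwined :: "(nat \<Rightarrow> nat \<Rightarrow> 'r) \<Rightarrow> (nat \<Rightarrow> nat \<Rightarrow> 'r) \<Rightarrow> bool" where
  "intertwined U U' \<longleftrightarrow>
     (\<forall>c\<in>A. \<forall>d\<in>A. mmult A (exchange x) U c d = mmult A U' (exchange x) c d)"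

lemma intertwined_mmult:
  assumes "intertwined U U'" "intertwined V V'"
  shows "intertwined (mmult A U V) (mmult A U' V')"
  unfolding intertwined_def
proof (intro ballI)
  fix c d assume cd: "c \<in> A" "d \<in> A"
  have "mmult A (exchange x) (mmult A U V) c d = mmult A (mmult A U' (exchange x)) V c d"
    unfolding mmult_assoc [symmetric]
    using assms(1) cd by - (rule mmult_cong, auto simp: intertwined_def)
  also have "\<dots> = mmult A U' (mmult A V' (exchange x)) c d"
    unfolding mmult_assoc
    using assms(2) cd by - (rule mmult_cong, auto simp: intertwined_def)
  finally show "mmult A (exchange x) (mmult A U V) c d
      = mmult A (mmult A U' V') (exchange x) c d"
    by (simp add: mmult_assoc)
qed

lemma intertwined_identity: "intertwined (\<lambda>c d. if c = d then 1 else 0) (\<lambda>c d. if c = d then 1 else 0)"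
  unfolding intertwined_def
  by (auto simp: exchange_left exchange_right)

lemma intertwined_link: "intertwined (link_matrix q x m) (link_matrix q x' m)"
proof -
  define \<theta> where "\<theta> = q * qnum q m"
  note J = link_adjacent[of m, folded \<theta>_def]
  show ?thesis
    unfolding intertwined_def
  proof (intro ballI)
    fix c d assume cd: "c \<in> A" "d \<in> A"
    show "mmult A (exchange x) (link_matrix q x m) c d = mmult A (link_matrix q x' m) (exchange x) c d"
      unfolding exchange_left[OF cd(1)] exchange_right[OF cd(2)] link_matrix_def
      using edge_weight_adjacent(3)[OF cd(1)] edge_weight_adjacent(4)[OF cd(2)] cd
      by (cases "c = a"; cases "c = b"; cases "d = a"; cases "d = b")
        (simp_all add: J, simp_all add: algebra_simps)
  qed
qed

lemma elementary_adjacent: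
  "elementary A g m = elementary (A - {a, b}) g m
     + (g a + g b) * (if m = 0 then 0 else elementary (A - {a, b}) g (m - 1))
     + g a * g b * (if m \<le> 1 then 0 else elementary (A - {a, b}) g (m - 2))"
proof -
  have "A = insert a (insert b (A - {a, b}))" using mem by auto
  then have "elementary A g m = elementary (insert a (insert b (A - {a, b}))) g m" by simp
  then show ?thesis
    using finite_colors by (simp add: elementary_insert algebra_simps numeral_2_eq_2)
qed

text \<open>
  Separating the interior colors \<open>a\<close> and \<open>b\<close> in the elementary polynomials leaves coefficients
  over the other colors.  These are unaffected by the exchange of the variables and do not
  distinguish \<open>a\<close> from \<open>b\<close> as end colors; what remains is a polynomial identity for each position of \<open>c\<close> and \<open>d\<close>.
\<close>

lemma intertwined_clique: "intertwined (clique_matrix q A x m) (clique_matrix q A x' m)"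
proof -
  define B where "B = A - {a, b}"
  define E where "E z c d m = elementary B (\<lambda>s. edge_weight q c s * edge_weight q s d * z s) m"
    for z :: "nat \<Rightarrow> 'r" and c d m
  define E1 where "E1 z c d = (if m = 0 then 0 else E z c d (m - 1))" for z c d
  define E2 where "E2 z c d = (if m \<le> 1 then 0 else E z c d (m - 2))" for z c d
  have C: "clique_matrix q A z m c d = edge_weight q c d * qfact q m * z d *
     (E z c d m + (edge_weight q c a * edge_weight q a d * z a + edge_weight q c b * edge_weight q b d * z b) * E1 z c d
      + edge_weight q c a * edge_weight q a d * z a * (edge_weight q c b * edge_weight q b d * z b) * E2 z c d)"
    for z c d
    unfolding clique_matrix_def elementary_adjacent E_def E1_def E2_def B_def by (simp add: mult_ac)
  have Ey: "E x' c d m' = E x c d m'" for c d m'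
    unfolding E_def by (intro elementary_cong) (auto simp: B_def)
  have Eb1: "E x b d m' = E x a d m'" for d m'
    unfolding E_def by (intro elementary_cong) (auto simp: B_def edge_weight_adjacent)
  have Eb2: "E x c b m' = E x c a m'" for c m'
    unfolding E_def by (intro elementary_cong) (auto simp: B_def edge_weight_adjacent)
  have E1: "E1 x' c d = E1 x c d" "E1 x b d = E1 x a d" "E1 x c b = E1 x c a"
     "E2 x' c d = E2 x c d" "E2 x b d = E2 x a d" "E2 x c b = E2 x c a" for c d
    by (simp_all add: E1_def E2_def Ey Eb1 Eb2)
  have K: "edge_weight q a b = q" "edge_weight q b a = 1"
    using less by (auto simp: edge_weight_def)
  show ?thesis
    unfolding intertwined_def
  proof (intro ballI)
    fix c d assume cd: "c \<in> A" "d \<in> A"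
    show "mmult A (exchange x) (clique_matrix q A x m) c d = mmult A (clique_matrix q A x' m) (exchange x) c d"
      unfolding exchange_left[OF cd(1)] exchange_right[OF cd(2)] C
      using edge_weight_adjacent(1,2)[OF cd(1)] edge_weight_adjacent(1,2)[OF cd(2)] cd
      by (cases "c = a"; cases "c = b"; cases "d = a"; cases "d = b")
        (simp_all add: Ey Eb1 Eb2 E1 K, simp_all add: algebra_simps)
  qed
qed

text \<open>Thus, unless the scalar is zero, \<open>exchange x\<close> is invertible over the fraction field and \<open>U\<close> determines \<open>U'\<close>.\<close>

lemma exchange_exchange:
  assumes "c \<in> A" "d \<in> A"
  shows "mmult A (exchange x) (exchange x') c d
           = (if c = d then (x a - q * x b) * (x b - q * x a) else 0)"
  unfolding exchange_left[OF assms(1)]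
  by (auto simp: exchange_def) (simp_all add: algebra_simps)

text \<open>
  Outside the rows \<open>a\<close> and \<open>b\<close>, the columns \<open>a\<close> and \<open>b\<close> of the link matrix are proportional to
  \<open>(x a, x b)\<close>; outside the columns \<open>a\<close> and \<open>b\<close>, its rows \<open>a\<close> and \<open>b\<close> agree.  The differences \<open>col\<close>
  and \<open>row\<close> below therefore involve only entries of \<open>U\<close> in two columns or two rows.  Computing the
  mixed difference of \<open>U L = L U\<close> over \<open>{a, b}\<close> in both ways gives the relation, up to the common
  factor \<open>1 + \<theta>\<close>.
\<close>

lemma commutes_with_link:
  assumes m: "qnum q (Suc m) \<noteq> 0"
    and comm: "\<And>c d. c \<in> A \<Longrightarrow> d \<in> A \<Longrightarrow>
          mmult A U (link_matrix q x m) c d = mmult A (link_matrix q x m) U c d"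
  shows "(1 - q) * x a * x b * (U a a - U b b) = (x a - x b) * (x a * U a b - q * x b * U b a)"
proof -
  define \<theta> where "\<theta> = q * qnum q m"
  note J = link_adjacent[of m, folded \<theta>_def]
  let ?N = "mmult A (link_matrix q x m) U"
  have col: "x a * ?N c b - x b * ?N c a
      = x a * x b * (1 + \<theta>) * (q * U c a - U c b)" if "c \<in> A" for c
  proof -
    have "x a * mmult A U (link_matrix q x m) c b - x b * mmult A U (link_matrix q x m) c a
       = x a * x b * (\<Sum>e\<in>A. U c e * (link q m e b - link q m e a))"
      by (simp add: mmult_def link_matrix_def sum_distrib_left sum_subtractf algebra_simps)
    also have "(\<Sum>e\<in>A. U c e * (link q m e b - link q m e a))
       = U c a * (link q m a b - link q m a a) + U c b * (link q m b b - link q m b a)"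
    proof -
      have "(\<Sum>e\<in>A - {a, b}. U c e * (link q m e b - link q m e a)) = 0"
        by (intro sum.neutral) (auto simp: edge_weight_adjacent)
      then show ?thesis by (simp add: sum_split)
    qed
    finally show ?thesis
      using that mem by (simp add: comm J algebra_simps)
  qed
  have row: "?N a d - ?N b d = (1 + \<theta>) * (q * x b * U b d - x a * U a d)" for d
  proof -
    have "?N a d - ?N b d = (\<Sum>e\<in>A. (link q m a e - link q m b e) * (x e * U e d))"
      by (simp add: mmult_def link_matrix_def sum_subtractf algebra_simps)
    also have "\<dots> = (link q m a a - link q m b a) * (x a * U a d) + (link q m a b - link q m b b) * (x b * U b d)"
    proof -
      have "(\<Sum>e\<in>A - {a, b}. (link q m a e - link q m b e) * (x e * U e d)) = 0"
        by (intro sum.neutral) (auto simp: edge_weight_adjacent)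
      then show ?thesis by (simp add: sum_split)
    qed
    finally show ?thesis
      by (simp add: J algebra_simps)
  qed
  have "(1 + \<theta>) * ((1 - q) * x a * x b * (U a a - U b b)) = (1 + \<theta>) * ((x a - x b) * (x a * U a b - q * x b * U b a))"
    using col[OF mem(1)] col[OF mem(2)] row[of a] row[of b] by algebra
  moreover have "1 + \<theta> \<noteq> 0"
    using m by (simp add: \<theta>_def link_Suc_sum)
  ultimately show ?thesis by (metis mult_cancel_left)
qed

text \<open>
  Multiplied by \<open>\<Theta>\<close>, the entries of \<open>U'\<close> are explicit combinations of those of \<open>U\<close>.  For the parts
  of the sum where at least one end has another color, this already suffices, since there \<open>a\<close> and
  \<open>b\<close> enter with equal weights \<open>K\<close>.  The entries at \<open>(a, b)\<close> and \<open>(b, a)\<close>, weighted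
  differently by the closing edge, are where the relation \<open>rel\<close> is used.
\<close>

lemma closing_edge_swap:
  assumes U: "intertwined U U'"
    and rel: "(1 - q) * x a * x b * (U a a - U b b) = (x a - x b) * (x a * U a b - q * x b * U b a)"
    and nz: "x a - q * x b \<noteq> 0" "x b - q * x a \<noteq> 0"
  shows "(\<Sum>c\<in>A. \<Sum>d\<in>A. edge_weight q c d * (x c * U c d))
       = (\<Sum>c\<in>A. \<Sum>d\<in>A. edge_weight q c d * (x' c * U' c d))"
proof -
  define \<Theta> where "\<Theta> = (x a - q * x b) * (x b - q * x a)"
  have nzT: "\<Theta> \<noteq> 0" using nz by (simp add: \<Theta>_def)
  have W: "\<Theta> * U' c d = mmult A (mmult A (exchange x) U) (exchange x') c d"
    if "c \<in> A" "d \<in> A" for c d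
  proof -
    have "mmult A (mmult A (exchange x) U) (exchange x') c d
        = mmult A (mmult A U' (exchange x)) (exchange x') c d"
      using U that by - (rule mmult_cong, auto simp: intertwined_def)
    also have "\<dots> = (\<Sum>e\<in>A. U' c e * (if e = d then \<Theta> else 0))"
      unfolding mmult_assoc using that
      by (subst mmult_def, intro sum.cong refl) (simp add: exchange_exchange \<Theta>_def)
    finally show ?thesis
      using that finite_colors by (simp add: mult.commute if_distrib cong: if_cong)
  qed
  have ent: "\<Theta> * U' c d = (let L = (\<lambda>d. if c = a then x a * (1 - q) * U a d + q * (x a - x b) * U b d
      else if c = b then (x a - x b) * U a d + x b * (1 - q) * U b d
      else (x a - q * x b) * U c d) in 
      (if d = a then L a * (x b * (1 - q)) + L b * (x b - x a)
      else if d = b then L a * (q * (x b - x a)) + L b * (x a * (1 - q))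
      else L d * (x b - q * x a)))" if "c \<in> A" "d \<in> A" for c d
    unfolding W[OF that] exchange_right[OF that(2)] exchange_left[OF that(1)] Let_def by simp
  have 1: "U' c d = U c d" if "c \<in> A - {a, b}" "d \<in> A - {a, b}" for c d
  proof -
    have "\<Theta> * U' c d = \<Theta> * U c d"
      using that by (subst ent) (simp_all add: \<Theta>_def)
    then show ?thesis using nzT by simp
  qed
  have 2: "U' c a + U' c b = U c a + U c b" if "c \<in> A - {a, b}" for c
  proof -
    have "\<Theta> * U' c a = (x a - q * x b) * U c a * (x b * (1 - q)) + (x a - q * x b) * U c b * (x b - x a)"
         "\<Theta> * U' c b = (x a - q * x b) * U c a * (q * (x b - x a)) + (x a - q * x b) * U c b * (x a * (1 - q))"
      using that ent[of c a] ent[of c b] mem by simp_all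
    then have "\<Theta> * (U' c a + U' c b) = \<Theta> * (U c a + U c b)"
      unfolding \<Theta>_def by algebra
    then show ?thesis using nzT by simp
  qed
  have 3: "x b * U' a d + x a * U' b d = x a * U a d + x b * U b d" if "d \<in> A - {a, b}" for d
  proof -
    have "\<Theta> * U' a d = (x a * (1 - q) * U a d + q * (x a - x b) * U b d) * (x b - q * x a)"
         "\<Theta> * U' b d = ((x a - x b) * U a d + x b * (1 - q) * U b d) * (x b - q * x a)"
      using that ent[of a d] ent[of b d] mem by simp_all
    then have "\<Theta> * (x b * U' a d + x a * U' b d) = \<Theta> * (x a * U a d + x b * U b d)"
      unfolding \<Theta>_def by algebra
    then show ?thesis using nzT by simp
  qed
  have 4: "x b * U' a b = x a * U a b"
  proof -
    have "\<Theta> * U' a b = (x a * (1 - q) * U a a + q * (x a - x b) * U b a) * (q * (x b - x a))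
       + (x a * (1 - q) * U a b + q * (x a - x b) * U b b) * (x a * (1 - q))"
      using ent[of a b] mem by simp
    then have "\<Theta> * (x b * U' a b) = \<Theta> * (x a * U a b)"
      using rel unfolding \<Theta>_def by algebra
    then show ?thesis using nzT by simp
  qed
  have 5: "x a * U' b a = x b * U b a"
  proof -
    have "\<Theta> * U' b a = ((x a - x b) * U a a + x b * (1 - q) * U b a) * (x b * (1 - q))
       + ((x a - x b) * U a b + x b * (1 - q) * U b b) * (x b - x a)"
      using ent[of b a] mem by simp
    then have "\<Theta> * (x a * U' b a) = \<Theta> * (x b * U b a)"
      using rel unfolding \<Theta>_def by algebra
    then show ?thesis using nzT by simp
  qed
  let ?f = "\<lambda>c d. edge_weight q c d * (x c * U c d)" and ?g = "\<lambda>c d. edge_weight q c d * (x' c * U' c d)"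
  let ?B = "A - {a, b}"
  have col: "?f c a + ?f c b = ?g c a + ?g c b" if "c \<in> ?B" for c
  proof -
    have "?f c a + ?f c b = edge_weight q c a * x c * (U c a + U c b)"
         "?g c a + ?g c b = edge_weight q c a * x c * (U' c a + U' c b)"
      using that by (simp_all add: edge_weight_adjacent algebra_simps)
    then show ?thesis using 2[OF that] by simp
  qed
  have row: "?f a d + ?f b d = ?g a d + ?g b d" if "d \<in> ?B" for d
  proof -
    have "?f a d + ?f b d = edge_weight q a d * (x a * U a d + x b * U b d)"
         "?g a d + ?g b d = edge_weight q a d * (x b * U' a d + x a * U' b d)"
      using that by (simp_all add: edge_weight_adjacent algebra_simps)
    then show ?thesis using 3[OF that] by simp
  qed
  have rest: "?f c d = ?g c d" if "c \<in> ?B" "d \<in> ?B" for c d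
    using that 1[OF that] by simp
  have split: "(\<Sum>c\<in>A. \<Sum>d\<in>A. h c d) = (h a a + h a b + h b a + h b b)
      + (\<Sum>d\<in>?B. h a d + h b d) + (\<Sum>c\<in>?B. h c a + h c b) + (\<Sum>c\<in>?B. \<Sum>d\<in>?B. h c d)"
    for h :: "nat \<Rightarrow> nat \<Rightarrow> 'r"
    by (simp add: sum_split[of "\<lambda>c. \<Sum>d\<in>A. h c d"] sum_split sum.distrib algebra_simps)
  have block: "?f a a + ?f a b + ?f b a + ?f b b = ?g a a + ?g a b + ?g b a + ?g b b"
    using 4 5 by simp
  show ?thesis
    unfolding split block
    by (intro arg_cong2[where f="(+)"] sum.cong refl col row rest)
qed

end

section \<open>Colorings of strings of mountains as matrix products\<close>

lemma sum_PiE_insert: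
  assumes "v \<notin> I"
  shows "(\<Sum>h\<in>insert v I \<rightarrow>\<^sub>E A. f h) = (\<Sum>d\<in>A. \<Sum>h\<in>I \<rightarrow>\<^sub>E A. f (h(v := d)))"
proof -
  have "(\<Sum>h\<in>insert v I \<rightarrow>\<^sub>E A. f h) = (\<Sum>(d, h)\<in>A \<times> (I \<rightarrow>\<^sub>E A). f (h(v := d)))"
    unfolding PiE_insert_eq
    by (subst sum.reindex[OF inj_combinator[OF assms]]) (simp add: case_prod_unfold o_def)
  then show ?thesis by (simp add: sum.cartesian_product)
qed

lemma sum_PiE_Un:
  assumes "I \<inter> I' = {}"
  shows "(\<Sum>h\<in>I \<union> I' \<rightarrow>\<^sub>E A. f h)
    = (\<Sum>g\<in>I \<rightarrow>\<^sub>E A. \<Sum>h\<in>I' \<rightarrow>\<^sub>E A. f (\<lambda>i. if i \<in> I then g i else h i))"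
proof -
  have "(\<Sum>h\<in>I \<union> I' \<rightarrow>\<^sub>E A. f h)
      = (\<Sum>(g, h)\<in>(I \<rightarrow>\<^sub>E A) \<times> (I' \<rightarrow>\<^sub>E A). f (\<lambda>i. if i \<in> I then g i else h i))"
  proof (rule sum.reindex_bij_witness[where j="\<lambda>\<kappa>. (restrict \<kappa> I, restrict \<kappa> I')"
        and i="\<lambda>(g, h) i. if i \<in> I then g i else h i"])
    fix \<kappa> assume "\<kappa> \<in> I \<union> I' \<rightarrow>\<^sub>E A"
    then show eq: "(case (restrict \<kappa> I, restrict \<kappa> I') of (g, h) \<Rightarrow> \<lambda>i. if i \<in> I then g i else h i) = \<kappa>"
      by (auto simp: fun_eq_iff PiE_def extensional_def)
    then show "(case (restrict \<kappa> I, restrict \<kappa> I') of (g, h) \<Rightarrow> f (\<lambda>i. if i \<in> I then g i else h i)) = f \<kappa>"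
      by simp
  next
    fix gh assume "gh \<in> (I \<rightarrow>\<^sub>E A) \<times> (I' \<rightarrow>\<^sub>E A)"
    then show "(restrict (case gh of (g, h) \<Rightarrow> \<lambda>i. if i \<in> I then g i else h i) I,
                restrict (case gh of (g, h) \<Rightarrow> \<lambda>i. if i \<in> I then g i else h i) I') = gh"
      using assms by (auto simp: fun_eq_iff PiE_def extensional_def disjoint_iff)
  qed (auto simp: PiE_iff extensional_def split: if_splits)
  then show ?thesis by (simp add: sum.cartesian_product)
qed

definition pairs :: "nat set \<Rightarrow> (nat \<times> nat) set" where
  "pairs I = {(u, v). u \<in> I \<and> v \<in> I \<and> u < v}"

definition weight :: "'r::comm_ring_1 \<Rightarrow> (nat \<times> nat) set \<Rightarrow> (nat \<Rightarrow> 'c::linorder) \<Rightarrow> 'r" where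
  "weight q F \<kappa> = (\<Prod>(u, v)\<in>F. edge_weight q (\<kappa> u) (\<kappa> v))"

lemma finite_pairs [simp]: "finite I \<Longrightarrow> finite (pairs I)"
  by (rule finite_subset[of _ "I \<times> I"]) (auto simp: pairs_def)

lemma weight_cong:
  assumes "F \<subseteq> pairs I" "\<And>v. v \<in> I \<Longrightarrow> \<kappa> v = \<kappa>' v"
  shows "weight q F \<kappa> = weight q F \<kappa>'"
  unfolding weight_def using assms by (intro prod.cong) (auto simp: pairs_def)

text \<open>
  The generating function of a complete graph is its \<open>q\<close>-factorial times an elementary symmetric
  polynomial, here with arbitrary values \<open>g\<close> of the variables.  That generality lets the
  induction remove the largest vertex: its color \<open>d\<close> is absorbed by rescaling \<open>g s\<close> to
  \<open>g s * edge_weight q s d\<close>.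
\<close>

lemma sum_clique_weights:
  fixes A :: "'c::linorder set"
  assumes "finite A" "finite I"
  shows "(\<Sum>h\<in>I \<rightarrow>\<^sub>E A. (\<Prod>u\<in>I. g (h u)) * weight q (pairs I) h)
           = qfact q (card I) * elementary A g (card I)"
  using assms(2)
proof (induction I arbitrary: g rule: finite_linorder_max_induct)
  case empty
  have "{S. S \<subseteq> A \<and> card S = 0} = {{}}"
    using assms(1) by (auto simp: card_eq_0_iff dest: finite_subset)
  then show ?case
    by (simp add: weight_def pairs_def qfact_def elementary_def)
next
  case (insert b I)
  have b: "b \<notin> I" using insert.hyps by auto
  define f where "f d S = g d * (\<Prod>s\<in>S. g s * edge_weight q s d)" for d S
  have pairs: "pairs (insert b I) = pairs I \<union> (\<lambda>u. (u, b)) ` I"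
    using insert.hyps by (auto simp: pairs_def)
  have w: "weight q (pairs (insert b I)) (h(b := d)) = weight q (pairs I) h * (\<Prod>u\<in>I. edge_weight q (h u) d)"
    for h :: "nat \<Rightarrow> 'c" and d
  proof -
    have "weight q (pairs (insert b I)) (h(b := d))
        = weight q (pairs I) (h(b := d)) * weight q ((\<lambda>u. (u, b)) ` I) (h(b := d))"
      unfolding weight_def pairs using insert.hyps b
      by (intro prod.union_disjoint finite_pairs finite_imageI) (auto simp: pairs_def)
    also have "weight q (pairs I) (h(b := d)) = weight q (pairs I) h"
      using b by (intro weight_cong[of _ I]) auto
    also have "weight q ((\<lambda>u. (u, b)) ` I) (h(b := d)) = (\<Prod>u\<in>I. edge_weight q (h u) d)"
      unfolding weight_def using b by (subst prod.reindex) (auto intro!: inj_onI prod.cong)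
    finally show ?thesis .
  qed
  have p: "(\<Prod>u\<in>insert b I. g ((h(b := d)) u)) = g d * (\<Prod>u\<in>I. g (h u))" for h d
  proof -
    have "(\<Prod>u\<in>I. g ((h(b := d)) u)) = (\<Prod>u\<in>I. g (h u))"
      using b by (intro prod.cong) auto
    then show ?thesis using insert.hyps b by (simp del: fun_upd_apply add: fun_upd_same)
  qed
  have "(\<Sum>h\<in>insert b I \<rightarrow>\<^sub>E A. (\<Prod>u\<in>insert b I. g (h u)) * weight q (pairs (insert b I)) h)
      = (\<Sum>d\<in>A. g d * (\<Sum>h\<in>I \<rightarrow>\<^sub>E A. (\<Prod>u\<in>I. g (h u) * edge_weight q (h u) d) * weight q (pairs I) h))"
    unfolding sum_PiE_insert[OF b] p w by (simp add: sum_distrib_left prod.distrib mult_ac)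
  also have "\<dots> = (\<Sum>d\<in>A. g d * (qfact q (card I) * elementary A (\<lambda>s. g s * edge_weight q s d) (card I)))"
    by (intro sum.cong arg_cong2[where f="(*)"] refl insert.IH)
  also have "\<dots> = qfact q (card I) * (\<Sum>d\<in>A. \<Sum>S | S \<subseteq> A \<and> card S = card I. f d S)"
    by (simp add: f_def elementary_def sum_distrib_left mult_ac)
  also have "(\<Sum>d\<in>A. \<Sum>S | S \<subseteq> A \<and> card S = card I. f d S)
      = (\<Sum>R | R \<subseteq> A \<and> card R = Suc (card I). \<Sum>s\<in>R. f s (R - {s}))"
  proof (intro sum_over_subset_with_element assms)
    fix s S assume "S \<subseteq> A" "s \<in> S"
    then have "(\<Prod>u\<in>S. g u * edge_weight q u s) = 0"
      using assms(1) finite_subset by (intro prod_zero bexI[of _ s]) auto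
    then show "f s S = 0" by (simp add: f_def)
  qed
  also have "\<dots> = (\<Sum>R | R \<subseteq> A \<and> card R = Suc (card I). qnum q (Suc (card I)) * (\<Prod>s\<in>R. g s))"
  proof (intro sum.cong refl)
    fix R assume "R \<in> {R. R \<subseteq> A \<and> card R = Suc (card I)}"
    then have R: "finite R" "card R = Suc (card I)"
      using assms(1) finite_subset by auto
    have "f s (R - {s}) = (\<Prod>s\<in>R. g s) * (\<Prod>u\<in>R - {s}. edge_weight q u s)" if "s \<in> R" for s
      using that R by (simp add: f_def prod.distrib prod.remove[of R s] mult_ac)
    then have "(\<Sum>s\<in>R. f s (R - {s})) = (\<Prod>s\<in>R. g s) * (\<Sum>s\<in>R. \<Prod>u\<in>R - {s}. edge_weight q u s)"
      by (simp add: sum_distrib_left)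
    then show "(\<Sum>s\<in>R. f s (R - {s})) = qnum q (Suc (card I)) * (\<Prod>s\<in>R. g s)"
      by (simp only: sum_prod_edge_weight[OF R(1)] R(2) mult.commute)
  qed
  finally show ?case
    using insert.hyps b by (simp add: qfact_Suc elementary_def sum_distrib_left mult_ac)
qed

definition mountain_pairs :: "mountain_type \<Rightarrow> nat \<Rightarrow> nat \<Rightarrow> (nat \<times> nat) set" where
  "mountain_pairs T l r = pairs {l..r} - (if T = Bottomless then {(l, r)} else {})"

definition mountain_matrix ::
  "'r::comm_ring_1 \<Rightarrow> nat set \<Rightarrow> (nat \<Rightarrow> 'r) \<Rightarrow> nat \<Rightarrow> mountain_type \<Rightarrow> nat \<Rightarrow> nat \<Rightarrow> 'r" where
  "mountain_matrix q A x m T =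
     (case T of Clique \<Rightarrow> clique_matrix q A x m | Bottomless \<Rightarrow> bottomless_matrix q A x m)"

lemma weight_mountain:
  assumes "l < r"
  shows "weight q (mountain_pairs T l r) \<kappa>
    = (if T = Clique then edge_weight q (\<kappa> l) (\<kappa> r) else 1)
      * (\<Prod>u\<in>{l<..<r}. edge_weight q (\<kappa> l) (\<kappa> u) * edge_weight q (\<kappa> u) (\<kappa> r))
      * weight q (pairs {l<..<r}) \<kappa>"
proof -
  let ?I = "{l<..<r}"
  let ?C = "if T = Clique then {(l, r)} else {}"
  have "mountain_pairs T l r = (?C \<union> (Pair l ` ?I \<union> (\<lambda>u. (u, r)) ` ?I)) \<union> pairs ?I"
    using assms by (cases T) (auto simp: mountain_pairs_def pairs_def image_iff)
  then have "weight q (mountain_pairs T l r) \<kappa>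
      = weight q ((?C \<union> (Pair l ` ?I \<union> (\<lambda>u. (u, r)) ` ?I)) \<union> pairs ?I) \<kappa>" by simp
  also have "\<dots> = weight q ?C \<kappa> * (weight q (Pair l ` ?I) \<kappa> * weight q ((\<lambda>u. (u, r)) ` ?I) \<kappa>)
                  * weight q (pairs ?I) \<kappa>"
    unfolding weight_def
    by (subst prod.union_disjoint, simp, simp, force simp: pairs_def,
        subst prod.union_disjoint, simp, simp, force,
        subst prod.union_disjoint) auto
  also have "weight q (Pair l ` ?I) \<kappa> = (\<Prod>u\<in>?I. edge_weight q (\<kappa> l) (\<kappa> u))"
    unfolding weight_def by (subst prod.reindex) (auto intro!: inj_onI)
  also have "weight q ((\<lambda>u. (u, r)) ` ?I) \<kappa> = (\<Prod>u\<in>?I. edge_weight q (\<kappa> u) (\<kappa> r))"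
    unfolding weight_def by (subst prod.reindex) (auto intro!: inj_onI)
  finally show ?thesis
    by (simp add: weight_def prod.distrib)
qed

text \<open>
  The left end \<open>l\<close> belongs to the preceding mountain and comes with a prescribed color \<open>e\<close>.  The
  function \<open>f\<close> of the color of the right end stands for whatever depends on the rest of the
  graph.
\<close>

lemma sum_mountain_weights:
  assumes "finite A" and r: "r = l + (case T of Clique \<Rightarrow> Suc m | Bottomless \<Rightarrow> Suc (Suc m))"
  shows "(\<Sum>h\<in>{l<..r} \<rightarrow>\<^sub>E A. f (h r) * (weight q (mountain_pairs T l r) (h(l := e)) * (\<Prod>v\<in>{l<..r}. x (h v))))
    = (\<Sum>d\<in>A. mountain_matrix q A x m T e d * f d)"
proof -
  have lr: "l < r" using r by (auto split: mountain_type.splits)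
  let ?I = "{l<..<r}"
  have I: "{l<..r} = insert r ?I" "r \<notin> ?I" using lr by auto
  let ?K = "edge_weight q"
  have split: "f ((h(r := d)) r) * (weight q (mountain_pairs T l r) (h(r := d, l := e)) * (\<Prod>v\<in>{l<..r}. x ((h(r := d)) v)))
      = (if T = Clique then ?K e d else 1) * x d * f d
        * ((\<Prod>u\<in>?I. ?K e (h u) * ?K (h u) d * x (h u)) * weight q (pairs ?I) h)" for h d
  proof -
    let ?k = "h(r := d, l := e)"
    have "weight q (mountain_pairs T l r) ?k = (if T = Clique then ?K e d else 1)
        * (\<Prod>u\<in>?I. ?K e (h u) * ?K (h u) d) * weight q (pairs ?I) h"
    proof -
      have "weight q (pairs ?I) ?k = weight q (pairs ?I) h"
        by (rule weight_cong[of _ ?I]) auto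
      moreover have "(\<Prod>u\<in>?I. ?K (?k l) (?k u) * ?K (?k u) (?k r)) = (\<Prod>u\<in>?I. ?K e (h u) * ?K (h u) d)"
        using lr by (intro prod.cong) auto
      ultimately show ?thesis
        using lr by (simp add: weight_mountain[OF lr])
    qed
    moreover have "(\<Prod>v\<in>{l<..r}. x ((h(r := d)) v)) = x d * (\<Prod>v\<in>?I. x (h v))"
      unfolding I(1) by (auto intro!: prod.cong)
    ultimately show ?thesis
      by (simp add: prod.distrib mult_ac)
  qed
  have "(\<Sum>h\<in>{l<..r} \<rightarrow>\<^sub>E A. f (h r) * (weight q (mountain_pairs T l r) (h(l := e)) * (\<Prod>v\<in>{l<..r}. x (h v))))
      = (\<Sum>d\<in>A. (if T = Clique then ?K e d else 1) * x d * f d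
          * (\<Sum>h\<in>?I \<rightarrow>\<^sub>E A. (\<Prod>u\<in>?I. ?K e (h u) * ?K (h u) d * x (h u)) * weight q (pairs ?I) h))"
  proof -
    have "(\<Sum>h\<in>{l<..r} \<rightarrow>\<^sub>E A. F h) = (\<Sum>d\<in>A. \<Sum>h\<in>?I \<rightarrow>\<^sub>E A. F (h(r := d)))" for F :: "(nat \<Rightarrow> nat) \<Rightarrow> 'a"
      unfolding I(1) by (rule sum_PiE_insert[OF I(2)])
    then show ?thesis
      by (simp only: split sum_distrib_left)
  qed
  also have "\<dots> = (\<Sum>d\<in>A. mountain_matrix q A x m T e d * f d)"
  proof (intro sum.cong refl)
    fix d
    have "(\<Sum>h\<in>?I \<rightarrow>\<^sub>E A. (\<Prod>u\<in>?I. ?K e (h u) * ?K (h u) d * x (h u)) * weight q (pairs ?I) h)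
      = qfact q (card ?I) * elementary A (\<lambda>s. ?K e s * ?K s d * x s) (card ?I)"
      using sum_clique_weights[OF assms(1), of ?I "\<lambda>s. ?K e s * ?K s d * x s" q] by simp
    then show "(if T = Clique then ?K e d else 1) * x d * f d
          * (\<Sum>h\<in>?I \<rightarrow>\<^sub>E A. (\<Prod>u\<in>?I. ?K e (h u) * ?K (h u) d * x (h u)) * weight q (pairs ?I) h)
        = mountain_matrix q A x m T e d * f d"
      using r by (cases T) (simp_all add: mountain_matrix_def clique_matrix_def bottomless_matrix_def mult_ac)
  qed
  finally show ?thesis .
qed

primrec string_matrix ::
  "'r::comm_ring_1 \<Rightarrow> nat set \<Rightarrow> (nat \<Rightarrow> 'r) \<Rightarrow> nat \<Rightarrow> (nat \<Rightarrow> mountain_type) \<Rightarrow> nat \<Rightarrow> nat \<Rightarrow> nat \<Rightarrow> 'r" where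
  "string_matrix q A x m t 0 = (\<lambda>c d. if c = d then 1 else 0)"
| "string_matrix q A x m t (Suc p) =
     mmult A (string_matrix q A x m t p) (mountain_matrix q A x m (t (Suc p)))"

abbreviation string_pairs :: "nat \<Rightarrow> (nat \<Rightarrow> mountain_type) \<Rightarrow> nat \<Rightarrow> (nat \<times> nat) set" where
  "string_pairs k t i \<equiv> mountain_pairs (t (Suc i)) (mountain_end k t i) (mountain_end k t (Suc i))"

lemma mountain_end_mono: "i \<le> j \<Longrightarrow> mountain_end k t i \<le> mountain_end k t j"
  by (induction j) (auto simp: le_Suc_eq)

lemma mountain_end_pos: "1 \<le> mountain_end k t i"
  using mountain_end_mono[of 0 i k t] by simp

text \<open>
  The function \<open>f\<close> of the two end colors is arbitrary so that the induction can absorb the last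
  mountain into it; the bottom edge is later inserted as \<open>f = edge_weight q\<close>.
\<close>

lemma sum_string_weights:
  assumes "finite A" and k: "k = m + 2"
  shows "(\<Sum>\<kappa>\<in>{1..mountain_end k t p} \<rightarrow>\<^sub>E A. f (\<kappa> 1) (\<kappa> (mountain_end k t p))
            * ((\<Prod>i<p. weight q (string_pairs k t i) \<kappa>) * (\<Prod>v\<in>{1..mountain_end k t p}. x (\<kappa> v))))
    = (\<Sum>c\<in>A. \<Sum>d\<in>A. f c d * (x c * string_matrix q A x m t p c d))"
proof (induction p arbitrary: f)
  case 0
  have "(\<Sum>\<kappa>\<in>{1..1::nat} \<rightarrow>\<^sub>E A. F \<kappa>) = (\<Sum>c\<in>A. F ((\<lambda>_. undefined)(1 := c)))" for F :: "(nat \<Rightarrow> nat) \<Rightarrow> 'a"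
    using sum_PiE_insert[of "1::nat" "{}" F A] by (simp add: PiE_empty_domain fun_upd_def)
  then show ?case
    using assms(1) by (simp add: if_distrib cong: if_cong)
next
  case (Suc p)
  define l r where "l = mountain_end k t p" and "r = mountain_end k t (Suc p)"
  let ?T = "t (Suc p)"
  have r: "r = l + (case ?T of Clique \<Rightarrow> Suc m | Bottomless \<Rightarrow> Suc (Suc m))"
    using k by (simp add: l_def r_def split: mountain_type.splits)
  then have lr: "1 \<le> l" "l < r"
    using mountain_end_pos by (auto simp: l_def split: mountain_type.splits)
  then have I: "{1..r} = {1..l} \<union> {l<..r}" "{1..l} \<inter> {l<..r} = {}" by auto
  define W where "W g = (\<Prod>i<p. weight q (string_pairs k t i) g) * (\<Prod>v\<in>{1..l}. x (g v))" for g
  let ?j = "\<lambda>g h (i::nat). if i \<in> {1..l} then g i else h i :: nat"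
  have split: "f (?j g h 1) (?j g h r) * ((\<Prod>i<Suc p. weight q (string_pairs k t i) (?j g h)) * (\<Prod>v\<in>{1..r}. x (?j g h v)))
      = W g * (f (g 1) (h r) * (weight q (mountain_pairs ?T l r) (h(l := g l)) * (\<Prod>v\<in>{l<..r}. x (h v))))" for g h
  proof -
    have "weight q (string_pairs k t i) (?j g h) = weight q (string_pairs k t i) g" if "i < p" for i
    proof (rule weight_cong[where I="{1..l}"])
      have "mountain_end k t (Suc i) \<le> l" "1 \<le> mountain_end k t i"
        using that mountain_end_mono[of "Suc i" p k t] mountain_end_pos by (auto simp: l_def)
      then show "string_pairs k t i \<subseteq> pairs {1..l}"
        by (auto simp: mountain_pairs_def pairs_def)
    qed auto
    then have "(\<Prod>i<p. weight q (string_pairs k t i) (?j g h)) = (\<Prod>i<p. weight q (string_pairs k t i) g)"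
      by simp
    moreover have "weight q (mountain_pairs ?T l r) (?j g h) = weight q (mountain_pairs ?T l r) (h(l := g l))"
      using lr by (intro weight_cong[where I="{l..r}"]) (auto simp: mountain_pairs_def)
    moreover have "(\<Prod>v\<in>{1..r}. x (?j g h v)) = (\<Prod>v\<in>{1..l}. x (g v)) * (\<Prod>v\<in>{l<..r}. x (h v))"
      unfolding I(1) by (subst prod.union_disjoint) (auto intro!: arg_cong2[where f="(*)"] prod.cong)
    ultimately show ?thesis
      using lr by (simp add: W_def l_def [symmetric] r_def [symmetric] mult_ac del: mountain_end.simps)
  qed
  have "(\<Sum>\<kappa>\<in>{1..r} \<rightarrow>\<^sub>E A. f (\<kappa> 1) (\<kappa> r)
            * ((\<Prod>i<Suc p. weight q (string_pairs k t i) \<kappa>) * (\<Prod>v\<in>{1..r}. x (\<kappa> v))))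
     = (\<Sum>g\<in>{1..l} \<rightarrow>\<^sub>E A. \<Sum>h\<in>{l<..r} \<rightarrow>\<^sub>E A.
          W g * (f (g 1) (h r) * (weight q (mountain_pairs ?T l r) (h(l := g l)) * (\<Prod>v\<in>{l<..r}. x (h v)))))"
  proof -
    have "(\<Sum>\<kappa>\<in>{1..r} \<rightarrow>\<^sub>E A. F \<kappa>) = (\<Sum>g\<in>{1..l} \<rightarrow>\<^sub>E A. \<Sum>h\<in>{l<..r} \<rightarrow>\<^sub>E A. F (?j g h))" for F :: "(nat \<Rightarrow> nat) \<Rightarrow> 'a"
      unfolding I(1) by (rule sum_PiE_Un[OF I(2)])
    then show ?thesis by (simp only: split)
  qed
  also have "\<dots> = (\<Sum>g\<in>{1..l} \<rightarrow>\<^sub>E A. W g * (\<Sum>d\<in>A. mountain_matrix q A x m ?T (g l) d * f (g 1) d))"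
    by (simp only: sum_distrib_left [symmetric] sum_mountain_weights[OF assms(1) r])
  also have "\<dots> = (\<Sum>g\<in>{1..l} \<rightarrow>\<^sub>E A. (\<lambda>c e. \<Sum>d\<in>A. mountain_matrix q A x m ?T e d * f c d) (g 1) (g l) * W g)"
    by (simp add: mult.commute)
  also have "\<dots> = (\<Sum>c\<in>A. \<Sum>e\<in>A. (\<Sum>d\<in>A. mountain_matrix q A x m ?T e d * f c d) * (x c * string_matrix q A x m t p c e))"
    unfolding W_def l_def by (rule Suc.IH)
  also have "\<dots> = (\<Sum>c\<in>A. \<Sum>d\<in>A. f c d * (x c * string_matrix q A x m t (Suc p) c d))"
  proof (rule sum.cong[OF refl])
    fix c
    have "(\<Sum>e\<in>A. (\<Sum>d\<in>A. mountain_matrix q A x m ?T e d * f c d) * (x c * string_matrix q A x m t p c e))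
       = (\<Sum>e\<in>A. \<Sum>d\<in>A. f c d * (x c * (string_matrix q A x m t p c e * mountain_matrix q A x m ?T e d)))"
      by (simp add: sum_distrib_left sum_distrib_right mult_ac)
    also have "\<dots> = (\<Sum>d\<in>A. \<Sum>e\<in>A. f c d * (x c * (string_matrix q A x m t p c e * mountain_matrix q A x m ?T e d)))"
      by (rule sum.swap)
    finally show "(\<Sum>e\<in>A. (\<Sum>d\<in>A. mountain_matrix q A x m ?T e d * f c d) * (x c * string_matrix q A x m t p c e))
       = (\<Sum>d\<in>A. f c d * (x c * string_matrix q A x m t (Suc p) c d))"
      by (simp add: mmult_def sum_distrib_left)
  qed
  finally show ?case unfolding r_def .
qed

section \<open>The bottom edge\<close>

lemma string_matrix_commutes:
  assumes "finite A" "c \<in> A" "d \<in> A"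
  shows "mmult A (string_matrix q A x m t p) (link_matrix q x m) c d
       = mmult A (link_matrix q x m) (string_matrix q A x m t p) c d"
  using assms(2,3)
proof (induction p arbitrary: c d)
  case 0
  then show ?case
    using assms(1) by (simp add: mmult_def if_distrib if_distribR cong: if_cong)
next
  case (Suc p)
  let ?J = "link_matrix q x m" and ?U = "string_matrix q A x m t p" and ?M = "mountain_matrix q A x m (t (Suc p))"
  have M: "mmult A ?M ?J = mmult A ?J ?M"
    using clique_link[OF assms(1), of q x m] link_clique[OF assms(1), of q x m]
    by (cases "t (Suc p)") (simp_all add: mountain_matrix_def, metis mmult_assoc)
  have "mmult A (mmult A ?U ?M) ?J c d = mmult A (mmult A ?U ?J) ?M c d"
    by (simp only: mmult_assoc M)
  also have "\<dots> = mmult A (mmult A ?J ?U) ?M c d"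
    using Suc.prems by - (rule mmult_cong, simp_all add: Suc.IH)
  finally show ?case
    by (simp add: mmult_assoc)
qed

context adjacent_colors
begin

text \<open>
  Since \<open>B = C L\<close>, the bottomless mountains need no computation of their own.
\<close>

lemma intertwined_string: "intertwined (string_matrix q A x m t p) (string_matrix q A x' m t p)"
proof (induction p)
  case 0
  then show ?case using intertwined_identity by simp
next
  case (Suc p)
  have "intertwined (mountain_matrix q A x m T) (mountain_matrix q A x' m T)" for T
    using intertwined_clique[of m] intertwined_mmult[OF intertwined_clique[of m] intertwined_link[of m]]
    by (cases T) (simp_all add: mountain_matrix_def clique_link[OF finite_colors])
  then show ?case
    using Suc by (simp add: intertwined_mmult)
qed

lemma closed_string_swap:
  assumes "qnum q (Suc m) \<noteq> 0" "x a - q * x b \<noteq> 0" "x b - q * x a \<noteq> 0"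
  shows "(\<Sum>c\<in>A. \<Sum>d\<in>A. edge_weight q c d * (x c * string_matrix q A x m t p c d))
       = (\<Sum>c\<in>A. \<Sum>d\<in>A. edge_weight q c d * (x' c * string_matrix q A x' m t p c d))"
  by (rule closing_edge_swap[OF intertwined_string
        commutes_with_link[OF assms(1) string_matrix_commutes[OF finite_colors]] assms(2,3)])

end

section \<open>The edges of a mixed mountain graph\<close>

definition graph_pairs :: "nat \<Rightarrow> nat \<Rightarrow> (nat \<Rightarrow> mountain_type) \<Rightarrow> (nat \<times> nat) set" where
  "graph_pairs p k t = insert (1, mountain_end k t p) (\<Union>i<p. string_pairs k t i)"

lemma mountain_end_less:
  assumes "k \<ge> 2" "i < j"
  shows "mountain_end k t i < mountain_end k t j"
proof -
  have "mountain_end k t i < mountain_end k t (Suc i)"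
    using assms(1) by (auto split: mountain_type.splits)
  also have "\<dots> \<le> mountain_end k t j"
    using assms(2) by (intro mountain_end_mono) simp
  finally show ?thesis .
qed

lemma string_pairs_disjoint:
  assumes "i < j"
  shows "string_pairs k t i \<inter> string_pairs k t j = {}"
  using mountain_end_mono[of "Suc i" j k t] assms
  by (fastforce simp: mountain_pairs_def pairs_def simp del: mountain_end.simps)

lemma finite_mountain_pairs [simp]: "finite (mountain_pairs T l r)"
  by (simp add: mountain_pairs_def)

text \<open>
  For \<open>p \<ge> 2\<close> no single mountain contains both \<open>1\<close> and \<open>n\<close>, so the bottom edge is a new edge.
\<close>

lemma weight_graph_pairs:
  assumes "p \<ge> 2" "k \<ge> 2"
  shows "weight q (graph_pairs p k t) \<kappa>
    = edge_weight q (\<kappa> 1) (\<kappa> (mountain_end k t p)) * (\<Prod>i<p. weight q (string_pairs k t i) \<kappa>)"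
proof -
  have "(1, mountain_end k t p) \<notin> string_pairs k t i" if "i < p" for i
  proof (cases "i = 0")
    case True
    then show ?thesis
      using mountain_end_less[OF assms(2), of 1 p t] assms(1)
      by (auto simp: mountain_pairs_def pairs_def simp del: mountain_end.simps)
  next
    case False
    then show ?thesis
      using mountain_end_less[OF assms(2), of 0 i t]
      by (auto simp: mountain_pairs_def pairs_def simp del: mountain_end.simps(2))
  qed
  then have n: "(1, mountain_end k t p) \<notin> (\<Union>i<p. string_pairs k t i)" by blast
  have "weight q (\<Union>i<p. string_pairs k t i) \<kappa> = (\<Prod>i<p. weight q (string_pairs k t i) \<kappa>)"
    unfolding weight_def
    by (rule prod.UNION_disjoint) (auto simp del: mountain_end.simps, metis disjoint_iff nat_neq_iff string_pairs_disjoint)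
  then show ?thesis
    unfolding graph_pairs_def using n by (simp add: weight_def)
qed

lemma mixed_mountain_edges_eq:
  assumes "k \<ge> 2"
  shows "mixed_mountain_edges p k t = (\<lambda>(u, v). {u, v}) ` graph_pairs p k t"
    (is "?E = ?f ` _")
proof -
  let ?l = "mountain_end k t"
  have "({{u, v} | u v. u < v \<and> (\<exists>i\<in>{1..p}. ?l (i - 1) \<le> u \<and> v \<le> ?l i)}
       - {{?l (i - 1), ?l i} | i. i \<in> {1..p} \<and> t i = Bottomless}) = ?f ` (\<Union>i<p. string_pairs k t i)"
    (is "?X - ?Y = _")
  proof (intro equalityI subsetI)
    fix e assume e: "e \<in> ?X - ?Y"
    then obtain u v i where uv: "e = {u, v}" "u < v" "i \<in> {1..p}" "?l (i - 1) \<le> u" "v \<le> ?l i"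
      by blast
    then obtain j where j: "i = Suc j" "j < p" by (cases i) auto
    have "\<not> (t i = Bottomless \<and> u = ?l (i - 1) \<and> v = ?l i)"
      using e uv by blast
    then have "(u, v) \<in> string_pairs k t j"
      using uv j by (auto simp: mountain_pairs_def pairs_def simp del: mountain_end.simps)
    then show "e \<in> ?f ` (\<Union>i<p. string_pairs k t i)"
      using uv(1) j(2) by (auto simp del: mountain_end.simps)
  next
    fix e assume "e \<in> ?f ` (\<Union>i<p. string_pairs k t i)"
    then obtain j u v where uv: "e = {u, v}" "j < p" "(u, v) \<in> string_pairs k t j"
      by (auto simp del: mountain_end.simps)
    then have uv': "u < v" "?l j \<le> u" "v \<le> ?l (Suc j)"
      "\<not> (t (Suc j) = Bottomless \<and> u = ?l j \<and> v = ?l (Suc j))"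
      by (auto simp: mountain_pairs_def pairs_def simp del: mountain_end.simps split: if_splits)
    have "e \<in> ?X"
    proof -
      have "\<exists>i\<in>{1..p}. ?l (i - 1) \<le> u \<and> v \<le> ?l i"
        using uv(2) uv' by (intro bexI[of _ "Suc j"]) auto
      then show ?thesis using uv(1) uv'(1) by blast
    qed
    moreover have "e \<notin> ?Y"
    proof
      assume "e \<in> ?Y"
      then obtain i where i: "e = {?l (i - 1), ?l i}" "i \<in> {1..p}" "t i = Bottomless" by blast
      then have "?l (i - 1) < ?l i" using mountain_end_less[OF assms, of "i - 1" i t] by auto
      then have eq: "u = ?l (i - 1)" "v = ?l i"
        using i(1) uv(1) uv'(1) by (auto simp: doubleton_eq_iff)
      have "i = Suc j"
      proof (rule ccontr)
        assume "i \<noteq> Suc j"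
        then consider "i \<le> j" | "Suc j \<le> i - 1" by linarith
        then show False
        proof cases
          case 1
          then show False using mountain_end_mono[OF 1, of k t] uv' eq by linarith
        next
          case 2
          then show False using mountain_end_mono[OF 2, of k t] uv' eq by linarith
        qed
      qed
      then show False using uv'(4) i(3) eq by simp
    qed
    ultimately show "e \<in> ?X - ?Y" by blast
  qed
  then show ?thesis
    unfolding mixed_mountain_edges_def graph_pairs_def by (simp del: mountain_end.simps)
qed

lemma weight_eq_asc:
  assumes "finite F" and "\<And>u v. (u, v) \<in> F \<Longrightarrow> u < v"
  defines "E \<equiv> (\<lambda>(u, v). {u, v}) ` F"
  shows "weight q F \<kappa> = (if \<forall>u v. {u, v} \<in> E \<longrightarrow> \<kappa> u \<noteq> \<kappa> v then q ^ asc E \<kappa> else 0)"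
proof (cases "\<forall>(u, v)\<in>F. \<kappa> u \<noteq> \<kappa> v")
  case True
  have proper: "\<forall>u v. {u, v} \<in> E \<longrightarrow> \<kappa> u \<noteq> \<kappa> v"
    using True unfolding E_def by (fastforce simp: doubleton_eq_iff)
  let ?up = "{(u, v) \<in> F. \<kappa> u < \<kappa> v}"
  have "{e \<in> E. \<exists>u v. e = {u, v} \<and> u < v \<and> \<kappa> u < \<kappa> v} = (\<lambda>(u, v). {u, v}) ` ?up"
  proof (intro equalityI subsetI)
    fix e assume "e \<in> {e \<in> E. \<exists>u v. e = {u, v} \<and> u < v \<and> \<kappa> u < \<kappa> v}"
    then obtain u v u' v' where *: "e = {u, v}" "u < v" "\<kappa> u < \<kappa> v" "(u', v') \<in> F" "e = {u', v'}"
      unfolding E_def by auto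
    then have "u' = u" "v' = v" using assms(2)[of u' v'] by (auto simp: doubleton_eq_iff)
    then show "e \<in> (\<lambda>(u, v). {u, v}) ` ?up" using * by auto
  next
    fix e assume "e \<in> (\<lambda>(u, v). {u, v}) ` ?up"
    then show "e \<in> {e \<in> E. \<exists>u v. e = {u, v} \<and> u < v \<and> \<kappa> u < \<kappa> v}"
      unfolding E_def using assms(2) by fastforce
  qed
  moreover have "inj_on (\<lambda>(u, v). {u, v}) ?up"
    using assms(2) by (fastforce simp: inj_on_def doubleton_eq_iff)
  ultimately have asc: "asc E \<kappa> = card ?up"
    unfolding asc_def by (simp add: card_image)
  have "weight q F \<kappa> = (\<Prod>e\<in>F. if e \<in> ?up then q else 1)"
    unfolding weight_def
  proof (intro prod.cong refl)
    fix e assume "e \<in> F"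
    then show "(case e of (u, v) \<Rightarrow> edge_weight q (\<kappa> u) (\<kappa> v)) = (if e \<in> ?up then q else 1)"
      using True by (cases e) (auto simp: edge_weight_def)
  qed
  also have "\<dots> = q ^ card ?up"
    using assms(1) by (simp add: prod.If_cases Int_def case_prod_unfold conj_commute)
  finally show ?thesis using proper asc by simp
next
  case False
  then obtain u v where uv: "(u, v) \<in> F" "\<kappa> u = \<kappa> v" by auto
  then have "{u, v} \<in> E" unfolding E_def by force
  moreover have "weight q F \<kappa> = 0"
    unfolding weight_def using assms(1) uv by (intro prod_zero bexI[of _ "(u, v)"]) auto
  ultimately show ?thesis using uv by auto
qed

section \<open>Coefficients\<close>

definition coloring_polynomial :: "nat \<Rightarrow> (nat \<times> nat) set \<Rightarrow> nat set \<Rightarrow> 'r \<Rightarrow> (nat \<Rightarrow> 'r) \<Rightarrow> 'r::comm_ring_1" where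
  "coloring_polynomial n F A q x = (\<Sum>\<kappa>\<in>{1..n} \<rightarrow>\<^sub>E A. weight q F \<kappa> * (\<Prod>v\<in>{1..n}. x (\<kappa> v)))"

lemma (in adjacent_colors) coloring_polynomial_swap:
  assumes "p \<ge> 2" "k = m + 2"
    and "qnum q (Suc m) \<noteq> 0" "x a - q * x b \<noteq> 0" "x b - q * x a \<noteq> 0"
  shows "coloring_polynomial (mountain_end k t p) (graph_pairs p k t) A q x
       = coloring_polynomial (mountain_end k t p) (graph_pairs p k t) A q x'"
proof -
  have "coloring_polynomial (mountain_end k t p) (graph_pairs p k t) A q z
      = (\<Sum>c\<in>A. \<Sum>d\<in>A. edge_weight q c d * (z c * string_matrix q A z m t p c d))" for z
    unfolding coloring_polynomial_def sum_string_weights[OF finite_colors assms(2), of "edge_weight q" t p q z, symmetric]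
    using assms(1,2) by (simp add: weight_graph_pairs mult.assoc)
  then show ?thesis
    using closed_string_swap[OF assms(3-5)] by simp
qed

text \<open>
  In this ring a monomial is the multiset of its variables.  It is an integral domain, as
  the cancellations in \<open>closing_edge_swap\<close> and \<open>commutes_with_link\<close> require.
\<close>

type_synonym series = "nat multiset \<Rightarrow>\<^sub>0 int poly"

definition qvar :: series where "qvar = Poly_Mapping.single {#} (monom 1 1)"
definition xvar :: "nat \<Rightarrow> series" where "xvar c = Poly_Mapping.single {#c#} 1"

lemma qvar_power: "qvar ^ j = Poly_Mapping.single {#} (monom 1 j)"
  by (induction j) (simp_all add: qvar_def mult_single mult_monom flip: single_one)

lemma prod_xvar: "finite S \<Longrightarrow> (\<Prod>v\<in>S. xvar (\<kappa> v)) = Poly_Mapping.single (image_mset \<kappa> (mset_set S)) 1"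
  by (induction S rule: finite_induct) (simp_all add: xvar_def mult_single flip: single_one)

text \<open>
  The bound \<open>N\<close> makes the truncation to the colors \<open>{1..N}\<close> invisible: a coloring with color content
  \<open>M\<close> has no other colors.
\<close>

lemma lookup_coloring_polynomial:
  assumes F: "finite F" "\<And>u v. (u, v) \<in> F \<Longrightarrow> u < v"
    and \<sigma>: "\<sigma> permutes {1..N}" and M: "\<And>c. c \<in># M \<Longrightarrow> c \<le> N"
  shows "Poly_Mapping.lookup (coloring_polynomial n F {1..N} qvar (xvar \<circ> \<sigma>)) (image_mset \<sigma> M)
       = chromatic_quasisymmetric n ((\<lambda>(u, v). {u, v}) ` F) M"
proof -
  let ?E = "(\<lambda>(u, v). {u, v}) ` F"
  let ?c = "\<lambda>\<kappa>. image_mset \<kappa> (mset_set {1..n})"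
  let ?proper = "\<lambda>\<kappa>. \<forall>u v. {u, v} \<in> ?E \<longrightarrow> \<kappa> u \<noteq> \<kappa> v"
  have inj: "image_mset \<sigma> M' = image_mset \<sigma> M \<longleftrightarrow> M' = M" for M'
  proof -
    have "image_mset (inv \<sigma>) (image_mset \<sigma> M') = M'" for M'
      by (simp add: multiset.map_comp permutes_inv_o[OF \<sigma>])
    then show ?thesis by metis
  qed
  have "Poly_Mapping.lookup (weight qvar F \<kappa> * (\<Prod>v\<in>{1..n}. (xvar \<circ> \<sigma>) (\<kappa> v))) (image_mset \<sigma> M)
      = (if ?proper \<kappa> \<and> ?c \<kappa> = M then monom 1 (asc ?E \<kappa>) else 0)" for \<kappa> :: "nat \<Rightarrow> nat"
  proof -
    have "(\<Prod>v\<in>{1..n}. (xvar \<circ> \<sigma>) (\<kappa> v)) = Poly_Mapping.single (image_mset \<sigma> (?c \<kappa>)) 1"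
      using prod_xvar[of "{1..n}" "\<sigma> \<circ> \<kappa>"] by (simp add: multiset.map_comp)
    then show ?thesis
      by (simp add: weight_eq_asc[OF F] qvar_power mult_single lookup_single inj when_def)
  qed
  then have "Poly_Mapping.lookup (coloring_polynomial n F {1..N} qvar (xvar \<circ> \<sigma>)) (image_mset \<sigma> M)
      = (\<Sum>\<kappa>\<in>{1..n} \<rightarrow>\<^sub>E {1..N}. if ?proper \<kappa> \<and> ?c \<kappa> = M then monom 1 (asc ?E \<kappa>) else 0)"
    by (simp only: coloring_polynomial_def lookup_sum)
  also have "\<dots> = (\<Sum>\<kappa> | \<kappa> \<in> {1..n} \<rightarrow>\<^sub>E {1..N} \<and> ?proper \<kappa> \<and> ?c \<kappa> = M. monom 1 (asc ?E \<kappa>))"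
    by (simp add: sum.inter_filter finite_PiE)
  also have "{\<kappa>. \<kappa> \<in> {1..n} \<rightarrow>\<^sub>E {1..N} \<and> ?proper \<kappa> \<and> ?c \<kappa> = M}
      = {\<kappa>. \<kappa> \<in> proper_colorings n ?E \<and> ?c \<kappa> = M}"
  proof -
    have "\<kappa> v \<le> N" if "?c \<kappa> = M" "v \<in> {1..n}" for \<kappa> v
      using that by (intro M) auto
    then show ?thesis
      unfolding proper_colorings_def by (auto simp: PiE_iff)
  qed
  finally show ?thesis
    unfolding chromatic_quasisymmetric_def .
qed

lemma qvar_nonzero:
  assumes "a \<noteq> b"
  shows "qnum qvar (Suc m) \<noteq> 0" "xvar a - qvar * xvar b \<noteq> 0"
proof -
  have "coeff (Poly_Mapping.lookup (qnum qvar (Suc m)) {#}) 0 = 1"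
    by (simp add: qnum_def qvar_power sum.lessThan_Suc_shift lookup_add lookup_sum coeff_sum
        del: sum.lessThan_Suc)
  then show "qnum qvar (Suc m) \<noteq> 0" by force
  have "Poly_Mapping.lookup (xvar a - qvar * xvar b) {#a#} = 1"
    using assms by (simp add: lookup_minus xvar_def qvar_def mult_single lookup_single)
  then show "xvar a - qvar * xvar b \<noteq> 0" by force
qed

lemma chromatic_swap:
  fixes t :: "nat \<Rightarrow> mountain_type"
  assumes p: "p \<ge> 2" and k: "k \<ge> 2" and a: "1 \<le> a"
  defines "X \<equiv> chromatic_quasisymmetric (mountain_end k t p) (mixed_mountain_edges p k t)"
  shows "X (image_mset (transpose a (Suc a)) M) = X M"
proof -
  obtain m where m: "k = m + 2" using k by (metis add.commute le_Suc_ex)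
  define N where "N = Max (insert (Suc a) (set_mset M))"
  have N: "c \<le> N" if "c \<in> insert (Suc a) (set_mset M)" for c
    unfolding N_def using that by (intro Max_ge) auto
  define F where "F = graph_pairs p k t"
  let ?n = "mountain_end k t p" and ?s = "transpose a (Suc a)"
  have F: "finite F" "\<And>u v. (u, v) \<in> F \<Longrightarrow> u < v"
  proof -
    show "finite F" by (simp add: F_def graph_pairs_def)
    show "u < v" if "(u, v) \<in> F" for u v
      using that mountain_end_less[OF k, of 0 p t] p
      by (auto simp: F_def graph_pairs_def mountain_pairs_def pairs_def)
  qed
  have X: "X = chromatic_quasisymmetric ?n ((\<lambda>(u, v). {u, v}) ` F)"
    unfolding X_def F_def mixed_mountain_edges_eq[OF k] ..
  have s: "?s permutes {1..N}"
    using a N[of "Suc a"] by (intro permutes_swap_id) auto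
  interpret adjacent_colors "{1..N}" a "Suc a" qvar xvar
    using a N[of "Suc a"] by unfold_locales auto
  have "coloring_polynomial ?n F {1..N} qvar xvar = coloring_polynomial ?n F {1..N} qvar (xvar \<circ> ?s)"
    using coloring_polynomial_swap[OF p m qvar_nonzero(1)[of a "Suc a"] qvar_nonzero(2) qvar_nonzero(2), of t]
    unfolding F_def x'_def by simp
  moreover have "X M = Poly_Mapping.lookup (coloring_polynomial ?n F {1..N} qvar (xvar \<circ> ?s)) (image_mset ?s M)"
    unfolding X using lookup_coloring_polynomial[OF F s, where M=M and n="?n"] N by simp
  moreover have "X (image_mset ?s M) = Poly_Mapping.lookup (coloring_polynomial ?n F {1..N} qvar xvar) (image_mset ?s M)"
  proof -
    have "c \<le> N" if "c \<in># image_mset ?s M" for c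
      using that N by (force simp: transpose_def)
    then show ?thesis
      unfolding X using lookup_coloring_polynomial[OF F permutes_id, where N=N and M="image_mset ?s M" and n="?n"] by simp
  qed
  ultimately show ?thesis by simp
qed

section \<open>From adjacent transpositions to all permutations\<close>

lemma extend_to_permutation:
  assumes "finite X" "inj_on f X"
  obtains p where "p permutes X \<union> f ` X" "\<And>i. i \<in> X \<Longrightarrow> p i = f i"
proof -
  let ?S = "X \<union> f ` X"
  have "card (?S - X) = card (?S - f ` X)"
    using assms by (simp add: card_Diff_subset card_image)
  then obtain h where h: "bij_betw h (?S - X) (?S - f ` X)"
    using assms(1) finite_same_card_bij[of "?S - X" "?S - f ` X"] by auto
  define p where "p = (\<lambda>i. if i \<in> X then f i else if i \<in> ?S then h i else i)"
  have "bij_betw p X (f ` X)"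
    using assms(2) by (simp add: bij_betw_def p_def inj_on_def)
  moreover have "bij_betw p (?S - X) (?S - f ` X)"
    using h by (subst bij_betw_cong[of _ _ h]) (auto simp: p_def)
  ultimately have "bij_betw p (X \<union> (?S - X)) (f ` X \<union> (?S - f ` X))"
    by (rule bij_betw_combine) auto
  moreover have "X \<union> (?S - X) = ?S" "f ` X \<union> (?S - f ` X) = ?S" by auto
  ultimately have "p permutes ?S"
    by (intro bij_imp_permutes) (auto simp: p_def)
  then show ?thesis using that by (simp add: p_def)
qed

text \<open>
  A permutation of all variables acts on one monomial like a permutation of finitely many, and
  those are generated by transpositions, which are built up from adjacent ones by conjugation.
\<close>

lemma symmetric_series_adjacent:
  assumes swap: "\<And>a M. 1 \<le> a \<Longrightarrow> F (image_mset (transpose a (Suc a)) M) = F M"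
  shows "symmetric_series F"
proof -
  have transp: "F (image_mset (transpose a b) M) = F M" if "1 \<le> a" "a < b" for a b M
    using that(2)
  proof (induction b arbitrary: M rule: less_induct)
    case (less b)
    then obtain b' where b': "b = Suc b'" "a \<le> b'" by (cases b) auto
    show ?case
    proof (cases "a = b'")
      case True
      then show ?thesis using swap that(1) b' by simp
    next
      case False
      have "transpose a b = transpose b' b \<circ> transpose a b' \<circ> transpose b' b"
        using False b' by (auto simp: fun_eq_iff transpose_def)
      then have "image_mset (transpose a b) M
          = image_mset (transpose b' b) (image_mset (transpose a b') (image_mset (transpose b' b) M))"
        by (simp add: multiset.map_comp comp_assoc)
      then show ?thesis
        using swap[of b'] less.IH[of b'] that(1) b' False by simp
    qed
  qed
  have finperm: "F (image_mset p M) = F M" if "p permutes S" "finite S" "S \<subseteq> {1..}" for p S M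
    using that(1,2)
  proof (induction arbitrary: M rule: permutes_induct)
    case id
    then show ?case by simp
  next
    case (swap a b p)
    have "F (image_mset (transpose a b) M) = F M" for M
      using transp[of a b] transp[of b a] swap(1-3) that(3)
      by (cases a b rule: linorder_cases) (auto simp: transpose_commute)
    moreover have "image_mset (transpose a b \<circ> p) M = image_mset (transpose a b) (image_mset p M)"
      by (simp add: multiset.map_comp)
    ultimately show ?case
      by (simp only: swap)
  qed
  show ?thesis
    unfolding symmetric_series_def permute_variables_def
  proof (intro allI impI ext)
    fix \<sigma> :: "nat \<Rightarrow> nat" and M :: "nat multiset" assume "\<sigma> permutes {1..}"
    then have \<sigma>: "inv \<sigma> permutes {1..}" by (rule permutes_inv)
    let ?X = "set_mset M \<inter> {1..}"
    have "inj_on (inv \<sigma>) ?X" using permutes_inj_on[OF \<sigma>] .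
    then obtain p where p: "p permutes ?X \<union> inv \<sigma> ` ?X" "\<And>i. i \<in> ?X \<Longrightarrow> p i = inv \<sigma> i"
      using extend_to_permutation[of ?X "inv \<sigma>"] by auto
    have S: "?X \<union> inv \<sigma> ` ?X \<subseteq> {1..}"
      using permutes_in_image[OF \<sigma>] by auto
    have "inv \<sigma> i = p i" if "i \<in># M" for i
    proof (cases "i \<in> {1..}")
      case False
      then have "i \<notin> ?X \<union> inv \<sigma> ` ?X" using S by blast
      then show ?thesis
        using permutes_not_in[OF \<sigma> False] permutes_not_in[OF p(1)] by metis
    qed (use p(2) that in auto)
    then have "image_mset (inv \<sigma>) M = image_mset p M"
      by (intro image_mset_cong) auto
    then show "F (image_mset (inv \<sigma>) M) = F M"
      using finperm[OF p(1) _ S] by simp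
  qed
qed

theorem theorem1p8:
  fixes p k n :: nat and E :: "nat set set"
  assumes "p \<ge> 2" and "k \<ge> 2"
    and "mixed_mountain_graph p k n E"
  shows "symmetric_series (chromatic_quasisymmetric n E)"
proof -
  obtain t where "n = mountain_end k t p" "E = mixed_mountain_edges p k t"
    using assms(3) unfolding mixed_mountain_graph_def by blast
  then show ?thesis
    using chromatic_swap[OF assms(1,2)] by (intro symmetric_series_adjacent) simp
qed

end
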